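(* Let $L/K$ be a separable field extension of possibly infinite degree, let $N/K$ be a normal closure of $L/K$, let $G$ be the Galois group of $N/K$, let $\{L_i\}_{i\in I}$ be the different conjugate fields of $L$ under the action of $G$, and let $(L/K,\beta)$ be the object crossed product defined by $L/K$ and $\beta$. Then the following assertions hold. (a) The $K$-algebra $(L/K,\beta)$ is simple. (b) The $K$-algebra $(L/K,\beta)$ is unital if and only if $I$ is finite. In that case, the center $Z((L/K,\beta))$ is a field which is isomorphic to $L^G$. (c) If $I$ is infinite, then $Z((L/K,\beta))=\{0\}$.
   Context: Construction of $(L/K,\beta)$. Let $L/K$ be a separable field extension and let $\overline{K}$ be a fixed algebraic closure of $K$ containing $L$. Let $N/K$ be a normal closure of $L/K$ in $\overline{K}$, let $G$ be the Galois group of $N/K$, and let $\{L_i\}_{i\in I}$ be the different conjugate fields of $L$ under the action of $G$. For $i,j\in I$ put $G_{ij}=\{g|_{L_j}\mid g\in G,\ g(L_j)=L_i\}$. Then $\mathcal{G}=\biguplus_{i,j\in I}G_{ij}$ is a groupoid under composition; for $\sigma\in G_{ij}$ one has $d(\sigma)=j$, $r(\sigma)=i$ (identifying $\mathrm{id}_{L_i}$ with $i$). The set of composable pairs is $\mathcal{G}_2=\{(\sigma,\tau)\mid d(\sigma)=r(\tau)\}$, and $\mathcal{G}_3$ is the set of composable triples. Let $\beta$ assign to each $(\sigma,\tau)\in\mathcal{G}_2$ an element $\beta_{\sigma,\tau}\in L_{r(\sigma)}\setminus\{0\}$ such that $\beta_{\sigma,d(\sigma)}=\beta_{r(\sigma),\sigma}=1$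 for all $\sigma\in\mathcal{G}$ and $\beta_{\sigma,\tau}\beta_{\sigma\tau,\rho}=\sigma(\beta_{\tau,\rho})\beta_{\sigma,\tau\rho}$ for all $(\sigma,\tau,\rho)\in\mathcal{G}_3$. The $K$-algebra $(L/K,\beta)$ is the additive group of formal sums $\sum_{\sigma\in\mathcal{G}}a_\sigma u_\sigma$ with $a_\sigma\in L_{r(\sigma)}$, almost all zero, with multiplication the additive extension of $xu_\sigma\cdot yu_\tau=x\sigma(y)\beta_{\sigma,\tau}u_{\sigma\tau}$ if $(\sigma,\tau)\in\mathcal{G}_2$, and $0$ otherwise. Algebras are associative and not necessarily unital. $L^G$ denotes the set of elements of $L$ fixed by every element of $G$, and $Z(S)$ denotes the center of a ring $S$.
   Formalization: In (b), L^G is taken as the elements of L fixed by those g in G with g(L)=L, not by every g in G; the literal L^G is K, and the claim then fails for K=Q, L=Q(cube root of 2), β=1, where the center is L. The two sets agree when L/K is normal. *)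

theory Defs
  imports "HOL-Algebra.Algebra"
begin

section \<open>Field extensions inside a fixed algebraic closure\<close>

text \<open>The ring \<open>\<Omega>\<close> is the ambient algebraic closure of the subfield \<open>K\<close>;
  all other fields are subfields of it, given by their carriers.\<close>

definition separable_extension :: "('a, 'm) ring_scheme \<Rightarrow> 'a set \<Rightarrow> 'a set \<Rightarrow> bool" where
  "separable_extension \<Omega> K L \<longleftrightarrow>
     subfield K \<Omega> \<and> subfield L \<Omega> \<and> K \<subseteq> L \<and>
     (\<forall>x\<in>L. ring.algebraic \<Omega> K x \<and>
        (\<forall>r\<in>carrier \<Omega>. ring.alg_mult \<Omega> (ring.Irr \<Omega> K x) r \<le> 1))"

text \<open>Splitting over \<open>N\<close> is expressed in the ring with carrier \<open>N\<close>; the library's \<open>splitted_on\<close>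
  is not usable, since it goes through \<open>mset_set N\<close>, which is empty for infinite \<open>N\<close>.\<close>

definition normal_extension :: "('a, 'm) ring_scheme \<Rightarrow> 'a set \<Rightarrow> 'a set \<Rightarrow> bool" where
  "normal_extension \<Omega> K N \<longleftrightarrow>
     subfield K \<Omega> \<and> subfield N \<Omega> \<and> K \<subseteq> N \<and>
     (\<forall>p\<in>carrier (K[X]\<^bsub>\<Omega>\<^esub>). pirreducible\<^bsub>\<Omega>\<^esub> K p \<longrightarrow>
        (\<exists>x\<in>N. ring.is_root \<Omega> p x) \<longrightarrow> ring.splitted (\<Omega>\<lparr>carrier := N\<rparr>) p)"

definition normal_closure :: "('a, 'm) ring_scheme \<Rightarrow> 'a set \<Rightarrow> 'a set \<Rightarrow> 'a set \<Rightarrow> bool" where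
  "normal_closure \<Omega> K L N \<longleftrightarrow>
     normal_extension \<Omega> K N \<and> L \<subseteq> N \<and>
     (\<forall>N'. normal_extension \<Omega> K N' \<longrightarrow> L \<subseteq> N' \<longrightarrow> N \<subseteq> N')"

text \<open>Extensionality makes each automorphism of \<open>N\<close> correspond to exactly one HOL function.\<close>

definition galois_group :: "('a, 'm) ring_scheme \<Rightarrow> 'a set \<Rightarrow> 'a set \<Rightarrow> ('a \<Rightarrow> 'a) set" where
  "galois_group \<Omega> K N =
     {g \<in> ring_iso (\<Omega>\<lparr>carrier := N\<rparr>) (\<Omega>\<lparr>carrier := N\<rparr>) \<inter> extensional N. \<forall>k\<in>K. g k = k}"

text \<open>The family of conjugate fields is indexed by itself, so that distinct indices
  belong to distinct fields.\<close>

definition conjugate_fields :: "('a \<Rightarrow> 'a) set \<Rightarrow> 'a set \<Rightarrow> 'a set set" where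
  "conjugate_fields G L = (\<lambda>g. g ` L) ` G"

text \<open>The group \<open>G\<close> consists of automorphisms of \<open>N\<close>, and \<open>g\<close> in \<open>G\<close> acts on \<open>L\<close> only if
  \<open>g ` L = L\<close>; the fixed field of \<open>G\<close> in \<open>L\<close> refers to these \<open>g\<close>.  Demanding
  \<open>g x = x\<close> from the remaining \<open>g\<close> too would always leave just \<open>K\<close>, as \<open>N\<close> is Galois over \<open>K\<close>.
  That differs from the center of the crossed product in general: for
  \<open>K\<close> the rationals, \<open>L = K(c)\<close> with \<open>c\<close> the real cube root of 2, and trivial \<open>\<beta>\<close>, the crossed
  product is the ring of 3 by 3 matrices over \<open>L\<close>, with center \<open>L\<close>.  Both sets
  agree if \<open>L\<close> is normal over \<open>K\<close>.\<close>

definition fixed_elements :: "('a \<Rightarrow> 'a) set \<Rightarrow> 'a set \<Rightarrow> 'a set" where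
  "fixed_elements G L = {x \<in> L. \<forall>g\<in>G. g ` L = L \<longrightarrow> g x = x}"

section \<open>The groupoid of a separable extension\<close>

text \<open>An isomorphism \<open>\<sigma>\<close> from \<open>L\<^sub>j\<close> to \<open>L\<^sub>i\<close> is encoded as a partial map, so that
  \<open>L\<^sub>j = dom \<sigma>\<close> plays the role of \<open>d(\<sigma>)\<close>, \<open>L\<^sub>i = ran \<sigma>\<close> that of \<open>r(\<sigma>)\<close>, the sets \<open>G\<^sub>i\<^sub>j\<close> are
  automatically disjoint, and composition is \<open>\<circ>\<^sub>m\<close>.\<close>

definition hom_set :: "('a \<Rightarrow> 'a) set \<Rightarrow> 'a set \<Rightarrow> 'a set \<Rightarrow> ('a \<rightharpoonup> 'a) set" where
  "hom_set G Li Lj = {(Some \<circ> g) |` Lj | g. g \<in> G \<and> g ` Lj = Li}"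

definition conj_groupoid :: "('a \<Rightarrow> 'a) set \<Rightarrow> 'a set \<Rightarrow> ('a \<rightharpoonup> 'a) set" where
  "conj_groupoid G L =
     (\<Union>Li\<in>conjugate_fields G L. \<Union>Lj\<in>conjugate_fields G L. hom_set G Li Lj)"

definition id_map :: "'a set \<Rightarrow> ('a \<rightharpoonup> 'a)" where
  "id_map S = Some |` S"

definition composable :: "('a \<rightharpoonup> 'a) \<Rightarrow> ('a \<rightharpoonup> 'a) \<Rightarrow> bool" where
  "composable \<sigma> \<tau> \<longleftrightarrow> dom \<sigma> = ran \<tau>"

definition cocycle ::
  "('a, 'm) ring_scheme \<Rightarrow> ('a \<rightharpoonup> 'a) set \<Rightarrow> (('a \<rightharpoonup> 'a) \<Rightarrow> ('a \<rightharpoonup> 'a) \<Rightarrow> 'a) \<Rightarrow> bool" where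
  "cocycle \<Omega> \<G> \<beta> \<longleftrightarrow>
     (\<forall>\<sigma>\<in>\<G>. \<forall>\<tau>\<in>\<G>. composable \<sigma> \<tau> \<longrightarrow> \<beta> \<sigma> \<tau> \<in> ran \<sigma> - {\<zero>\<^bsub>\<Omega>\<^esub>}) \<and>
     (\<forall>\<sigma>\<in>\<G>. \<beta> \<sigma> (id_map (dom \<sigma>)) = \<one>\<^bsub>\<Omega>\<^esub> \<and> \<beta> (id_map (ran \<sigma>)) \<sigma> = \<one>\<^bsub>\<Omega>\<^esub>) \<and>
     (\<forall>\<sigma>\<in>\<G>. \<forall>\<tau>\<in>\<G>. \<forall>\<rho>\<in>\<G>. composable \<sigma> \<tau> \<longrightarrow> composable \<tau> \<rho> \<longrightarrow>
        \<beta> \<sigma> \<tau> \<otimes>\<^bsub>\<Omega>\<^esub> \<beta> (\<sigma> \<circ>\<^sub>m \<tau>) \<rho> = the (\<sigma> (\<beta> \<tau> \<rho>)) \<otimes>\<^bsub>\<Omega>\<^esub> \<beta> \<sigma> (\<tau> \<circ>\<^sub>m \<rho>))"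

section \<open>Associative, not necessarily unital algebras\<close>

text \<open>The library's \<open>algebra\<close> locale covers commutative unital algebras only.  Below,
  the record component \<open>one\<close> of the algebra is unconstrained.\<close>

locale assoc_algebra = module R A for R (structure) and A (structure) +
  assumes mult_closed: "\<lbrakk>x \<in> carrier A; y \<in> carrier A\<rbrakk> \<Longrightarrow> x \<otimes>\<^bsub>A\<^esub> y \<in> carrier A"
    and mult_assoc: "\<lbrakk>x \<in> carrier A; y \<in> carrier A; z \<in> carrier A\<rbrakk>
          \<Longrightarrow> (x \<otimes>\<^bsub>A\<^esub> y) \<otimes>\<^bsub>A\<^esub> z = x \<otimes>\<^bsub>A\<^esub> (y \<otimes>\<^bsub>A\<^esub> z)"
    and mult_l_distr: "\<lbrakk>x \<in> carrier A; y \<in> carrier A; z \<in> carrier A\<rbrakk>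
          \<Longrightarrow> (x \<oplus>\<^bsub>A\<^esub> y) \<otimes>\<^bsub>A\<^esub> z = x \<otimes>\<^bsub>A\<^esub> z \<oplus>\<^bsub>A\<^esub> y \<otimes>\<^bsub>A\<^esub> z"
    and mult_r_distr: "\<lbrakk>x \<in> carrier A; y \<in> carrier A; z \<in> carrier A\<rbrakk>
          \<Longrightarrow> z \<otimes>\<^bsub>A\<^esub> (x \<oplus>\<^bsub>A\<^esub> y) = z \<otimes>\<^bsub>A\<^esub> x \<oplus>\<^bsub>A\<^esub> z \<otimes>\<^bsub>A\<^esub> y"
    and smult_mult_left: "\<lbrakk>a \<in> carrier R; x \<in> carrier A; y \<in> carrier A\<rbrakk>
          \<Longrightarrow> (a \<odot>\<^bsub>A\<^esub> x) \<otimes>\<^bsub>A\<^esub> y = a \<odot>\<^bsub>A\<^esub> (x \<otimes>\<^bsub>A\<^esub> y)"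
    and smult_mult_right: "\<lbrakk>a \<in> carrier R; x \<in> carrier A; y \<in> carrier A\<rbrakk>
          \<Longrightarrow> x \<otimes>\<^bsub>A\<^esub> (a \<odot>\<^bsub>A\<^esub> y) = a \<odot>\<^bsub>A\<^esub> (x \<otimes>\<^bsub>A\<^esub> y)"

definition two_sided_ideal :: "'b set \<Rightarrow> ('b, 'm) ring_scheme \<Rightarrow> bool" where
  "two_sided_ideal J A \<longleftrightarrow>
     additive_subgroup J A \<and>
     (\<forall>x\<in>carrier A. \<forall>y\<in>J. x \<otimes>\<^bsub>A\<^esub> y \<in> J \<and> y \<otimes>\<^bsub>A\<^esub> x \<in> J)"

text \<open>Ideals are ring ideals, not assumed to be stable under scalars; without a unit this is
  a priori the stronger form of simplicity.\<close>

definition simple_algebra ::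
  "('k, 'm) ring_scheme \<Rightarrow> ('k, 'b, 'n) module_scheme \<Rightarrow> bool" where
  "simple_algebra R A \<longleftrightarrow>
     assoc_algebra R A \<and>
     (\<exists>x\<in>carrier A. \<exists>y\<in>carrier A. x \<otimes>\<^bsub>A\<^esub> y \<noteq> \<zero>\<^bsub>A\<^esub>) \<and>
     (\<forall>J. two_sided_ideal J A \<longrightarrow> J = {\<zero>\<^bsub>A\<^esub>} \<or> J = carrier A)"

definition unital :: "('b, 'm) ring_scheme \<Rightarrow> bool" where
  "unital A \<longleftrightarrow>
     (\<exists>e\<in>carrier A. \<forall>x\<in>carrier A. e \<otimes>\<^bsub>A\<^esub> x = x \<and> x \<otimes>\<^bsub>A\<^esub> e = x)"

definition center :: "('b, 'm) ring_scheme \<Rightarrow> ('b, 'm) ring_scheme" where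
  "center A =
     A\<lparr>carrier := {z \<in> carrier A. \<forall>x\<in>carrier A. z \<otimes>\<^bsub>A\<^esub> x = x \<otimes>\<^bsub>A\<^esub> z}\<rparr>"

section \<open>Object crossed products\<close>

definition support :: "('a, 'm) ring_scheme \<Rightarrow> ('s \<Rightarrow> 'a) \<Rightarrow> 's set" where
  "support \<Omega> f = {\<sigma>. f \<sigma> \<noteq> \<zero>\<^bsub>\<Omega>\<^esub>}"

text \<open>The formal sum of the \<open>a\<^sub>\<sigma> u\<^sub>\<sigma>\<close> is its coefficient function, set to zero outside the groupoid.
  The component \<open>one\<close> is the formal sum of all \<open>u\<^sub>\<sigma>\<close> with \<open>\<sigma>\<close> an identity; it belongs to the
  carrier only if there are finitely many conjugate fields.\<close>

definition crossed_product ::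
  "('a, 'm) ring_scheme \<Rightarrow> ('a \<Rightarrow> 'a) set \<Rightarrow> 'a set \<Rightarrow> (('a \<rightharpoonup> 'a) \<Rightarrow> ('a \<rightharpoonup> 'a) \<Rightarrow> 'a)
     \<Rightarrow> ('a, ('a \<rightharpoonup> 'a) \<Rightarrow> 'a) module" where
  "crossed_product \<Omega> G L \<beta> =
     \<lparr>carrier = {f. (\<forall>\<sigma>\<in>conj_groupoid G L. f \<sigma> \<in> ran \<sigma>) \<and>
                    support \<Omega> f \<subseteq> conj_groupoid G L \<and> finite (support \<Omega> f)},
      monoid.mult = (\<lambda>f h \<rho>.
        finsum \<Omega> (\<lambda>(\<sigma>, \<tau>). f \<sigma> \<otimes>\<^bsub>\<Omega>\<^esub> the (\<sigma> (h \<tau>)) \<otimes>\<^bsub>\<Omega>\<^esub> \<beta> \<sigma> \<tau>)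
          {(\<sigma>, \<tau>) \<in> support \<Omega> f \<times> support \<Omega> h. composable \<sigma> \<tau> \<and> \<sigma> \<circ>\<^sub>m \<tau> = \<rho>}),
      one = (\<lambda>\<sigma>. if \<sigma> \<in> id_map ` conjugate_fields G L then \<one>\<^bsub>\<Omega>\<^esub> else \<zero>\<^bsub>\<Omega>\<^esub>),
      ring.zero = (\<lambda>_. \<zero>\<^bsub>\<Omega>\<^esub>),
      ring.add = (\<lambda>f h \<sigma>. f \<sigma> \<oplus>\<^bsub>\<Omega>\<^esub> h \<sigma>),
      smult = (\<lambda>k f \<sigma>. k \<otimes>\<^bsub>\<Omega>\<^esub> f \<sigma>)\<rparr>"

end

theory Submission
  imports Defs
begin

text \<open>In the groupoid algebra, multiplication by \<open>a u\<^sub>e\<close> with \<open>e\<close> an identity scales the coefficient at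
  \<open>\<sigma>\<close> by \<open>a\<close> on the left if \<open>r(\<sigma>) = e\<close> and by \<open>\<sigma>(a)\<close> on the right if \<open>d(\<sigma>) = e\<close>. Comparing the two
  for all \<open>a\<close> forces \<open>\<sigma> = e\<close>. Applied to a nonzero element of minimal support in an ideal, suitably
  translated, this yields some \<open>c u\<^sub>e\<close> in the ideal, and the groupoid is connected and \<open>c\<close> invertible, so
  the ideal is everything. Applied to a central element it shows that the element is a sum of
  \<open>c\<^sub>e u\<^sub>e\<close> over identities \<open>e\<close>; commutation with \<open>u\<^sub>\<sigma>\<close> means \<open>c\<^sub>r\<^sub>(\<^sub>\<sigma>\<^sub>) = \<sigma>(c\<^sub>d\<^sub>(\<^sub>\<sigma>\<^sub>))\<close>, so
  the coefficient at \<open>L\<close> is fixed by the automorphisms of \<open>L\<close> in the groupoid and determines all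
  others. If there are infinitely many conjugate fields, finiteness of the support leaves
  only zero.\<close>

text \<open>Reversing a ring isomorphism out of the center, as \<open>center_field\<close> does,
  requires the center to be known as a ring first.\<close>

lemma (in ring) center_ring: "ring (center R)"
proof -
  have "subring {z \<in> carrier R. \<forall>x\<in>carrier R. z \<otimes> x = x \<otimes> z} R"
  proof (rule subringI)
    fix z w assume *: "z \<in> {z \<in> carrier R. \<forall>x\<in>carrier R. z \<otimes> x = x \<otimes> z}"
      "w \<in> {z \<in> carrier R. \<forall>x\<in>carrier R. z \<otimes> x = x \<otimes> z}"
    then have zw: "z \<in> carrier R" "w \<in> carrier R" by simp_all
    have "(z \<otimes> w) \<otimes> x = x \<otimes> (z \<otimes> w)" if x: "x \<in> carrier R" for x
    proof -
      have comm: "z \<otimes> x = x \<otimes> z" "w \<otimes> x = x \<otimes> w" using * x by blast+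
      have "(z \<otimes> w) \<otimes> x = z \<otimes> (x \<otimes> w)" unfolding m_assoc[OF zw x] comm(2) ..
      also have "\<dots> = x \<otimes> (z \<otimes> w)"
        unfolding m_assoc[OF zw(1) x zw(2), symmetric] comm(1) m_assoc[OF x zw] ..
      finally show ?thesis .
    qed
    with zw show "z \<otimes> w \<in> {z \<in> carrier R. \<forall>x\<in>carrier R. z \<otimes> x = x \<otimes> z}"
      by blast
  qed (auto simp: l_minus r_minus l_distr r_distr)
  then show ?thesis unfolding center_def by (rule subring_is_ring)
qed

subsection \<open>The groupoid of conjugate fields\<close>

locale galois_conjugates = field \<Omega> for \<Omega> (structure) +
  fixes K L N :: "'a set" and G :: "('a \<Rightarrow> 'a) set"
  assumes subfield_K: "subfield K \<Omega>" and subfield_L: "subfield L \<Omega>" and subfield_N: "subfield N \<Omega>"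
    and K_subset: "K \<subseteq> L" and L_subset: "L \<subseteq> N"
    and G_eq: "G = galois_group \<Omega> K N"
begin

abbreviation objects :: "'a set set" where "objects \<equiv> conjugate_fields G L"
abbreviation groupoid :: "('a \<rightharpoonup> 'a) set" where "groupoid \<equiv> conj_groupoid G L"
text \<open>Outside \<open>dom \<phi>\<close> the value is unspecified, so most laws for
  \<open>act\<close> carry a domain hypothesis.\<close>

abbreviation act :: "('a \<rightharpoonup> 'a) \<Rightarrow> 'a \<Rightarrow> 'a" where "act \<phi> x \<equiv> the (\<phi> x)"

section \<open>The Galois group of \<open>N\<close> over \<open>K\<close>\<close>

lemma N_carrier: "x \<in> N \<Longrightarrow> x \<in> carrier \<Omega>"
  using subfieldE(3)[OF subfield_N] by auto

lemma G_iso: "g \<in> G \<Longrightarrow> g \<in> ring_iso (\<Omega>\<lparr>carrier := N\<rparr>) (\<Omega>\<lparr>carrier := N\<rparr>)"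
  and G_fixes: "g \<in> G \<Longrightarrow> k \<in> K \<Longrightarrow> g k = k"
  by (auto simp: G_eq galois_group_def)

text \<open>\<open>galois_group\<close> demands extensionality, so composites and inverses become
  members only after restriction to \<open>N\<close>. Restriction keeps the homomorphism laws
  because \<open>N\<close> is closed under the operations.\<close>

lemma G_memI:
  assumes "g \<in> ring_iso (\<Omega>\<lparr>carrier := N\<rparr>) (\<Omega>\<lparr>carrier := N\<rparr>)" "\<And>k. k \<in> K \<Longrightarrow> g k = k"
  shows "restrict g N \<in> G"
proof -
  interpret N: ring "\<Omega>\<lparr>carrier := N\<rparr>"
    using subring_is_ring subfieldE(1) subfield_N by blast
  have "restrict g N \<in> ring_iso (\<Omega>\<lparr>carrier := N\<rparr>) (\<Omega>\<lparr>carrier := N\<rparr>)"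
    using assms(1) N.m_closed N.a_closed N.one_closed
    by (auto intro!: ring_iso_memI simp: ring_iso_memE)
       (auto simp: ring_iso_def ring_hom_def)
  then show ?thesis
    using assms(2) K_subset L_subset by (auto simp: G_eq galois_group_def)
qed

lemma G_bij: "g \<in> G \<Longrightarrow> bij_betw g N N"
  using ring_iso_memE(5)[OF G_iso] by simp

lemma G_closed: "g \<in> G \<Longrightarrow> x \<in> N \<Longrightarrow> g x \<in> N"
  using G_bij bij_betwE by blast

lemma G_id: "restrict id N \<in> G"
  by (rule G_memI) (simp_all add: ring_iso_set_refl)

lemma G_comp: "g \<in> G \<Longrightarrow> h \<in> G \<Longrightarrow> restrict (g \<circ> h) N \<in> G"
  by (rule G_memI) (auto intro: ring_iso_set_trans G_iso simp: G_fixes)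

lemma G_inv:
  assumes "g \<in> G" shows "restrict (inv_into N g) N \<in> G"
proof (rule G_memI)
  have "ring (\<Omega>\<lparr>carrier := N\<rparr>)"
    using subring_is_ring subfieldE(1) subfield_N by blast
  from ring_iso_set_sym[OF this G_iso[OF assms]]
  show "inv_into N g \<in> ring_iso (\<Omega>\<lparr>carrier := N\<rparr>) (\<Omega>\<lparr>carrier := N\<rparr>)" by simp
  fix k assume "k \<in> K"
  then show "inv_into N g k = k"
    using G_fixes[OF assms] K_subset L_subset G_bij[OF assms]
    by (metis bij_betw_imp_inj_on inv_into_f_f subsetD)
qed

section \<open>Conjugate fields\<close>

lemma objectsE:
  assumes "S \<in> objects"
  obtains h where "h \<in> G" "S = h ` L"
  using assms by (auto simp: conjugate_fields_def)

lemma object_subset: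
  assumes "S \<in> objects" shows "S \<subseteq> N" and "K \<subseteq> S"
proof -
  obtain h where h: "h \<in> G" "S = h ` L" using assms by (rule objectsE)
  show "S \<subseteq> N" using h G_closed L_subset by auto
  show "K \<subseteq> S" using h G_fixes[of h] K_subset by force
qed

lemma G_object:
  assumes "g \<in> G" "S \<in> objects" shows "g ` S \<in> objects"
proof -
  obtain h where h: "h \<in> G" "S = h ` L" using assms(2) by (rule objectsE)
  have "g ` S = restrict (g \<circ> h) N ` L"
    using h L_subset by (auto simp: image_iff)
  then show ?thesis using G_comp[OF assms(1) h(1)] unfolding conjugate_fields_def by blast
qed

text \<open>The image of a subfield under a ring homomorphism into a field is a subfield; here
  \<open>h\<close> is read as a homomorphism from \<open>N\<close> into \<Omega>.\<close>

lemma object_subfield: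
  assumes "S \<in> objects" shows "subfield S \<Omega>"
proof -
  obtain h where h: "h \<in> G" "S = h ` L" using assms by (rule objectsE)
  have rN: "ring (\<Omega>\<lparr>carrier := N\<rparr>)"
    using subring_is_ring subfieldE(1) subfield_N by blast
  have "h \<in> ring_hom (\<Omega>\<lparr>carrier := N\<rparr>) \<Omega>"
    using G_iso[OF h(1)] N_carrier by (auto simp: ring_iso_def ring_hom_def)
  then interpret H: ring_hom_ring "\<Omega>\<lparr>carrier := N\<rparr>" \<Omega> h
    using rN ring_axioms by (simp add: ring_hom_ringI2)
  \<comment> \<open>By \<open>subfield_iff\<close> the property depends on the field with carrier
    \<open>L\<close> alone, so it passes from \<Omega> to the ring with carrier \<open>N\<close>,
    the source of \<open>h\<close>.\<close>
  have "subfield L (\<Omega>\<lparr>carrier := N\<rparr>)"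
    using ring.subfield_iff(1)[OF rN, of L] subfield_iff(2)[OF subfield_L] L_subset by simp
  then show ?thesis using H.img_is_subfield(2) h(2) by simp
qed

section \<open>Groupoid elements as restricted automorphisms\<close>

lemma dom_Some_restrict: "dom ((Some \<circ> g) |` S) = S"
  by (auto simp: restrict_map_def dom_def)

lemma ran_Some_restrict: "ran ((Some \<circ> g) |` S) = g ` S"
  by (auto simp: restrict_map_def ran_def)

lemma Some_restrict_cong: "(\<And>x. x \<in> S \<Longrightarrow> g x = h x) \<Longrightarrow> (Some \<circ> g) |` S = (Some \<circ> h) |` S"
  by (simp add: restrict_map_def fun_eq_iff)

lemma Some_restrict_comp:
  "((Some \<circ> g) |` (h ` S)) \<circ>\<^sub>m ((Some \<circ> h) |` S) = (Some \<circ> (g \<circ> h)) |` S"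
  by (simp add: restrict_map_def map_comp_def fun_eq_iff)

lemma id_map_eq: "id_map S = (Some \<circ> (\<lambda>x. x)) |` S"
  by (simp add: id_map_def restrict_map_def fun_eq_iff)

lemma groupoidE:
  assumes "\<phi> \<in> groupoid"
  obtains g S where "g \<in> G" "S \<in> objects" "\<phi> = (Some \<circ> g) |` S" "dom \<phi> = S" "ran \<phi> = g ` S"
proof -
  obtain g S where g: "g \<in> G" "S \<in> objects" "\<phi> = (Some \<circ> g) |` S"
    using assms by (auto simp: conj_groupoid_def hom_set_def)
  have "dom \<phi> = S" "ran \<phi> = g ` S"
    by (simp_all only: g(3) dom_Some_restrict ran_Some_restrict)
  with g show thesis by (rule that)
qed

lemma groupoidI: "g \<in> G \<Longrightarrow> S \<in> objects \<Longrightarrow> (Some \<circ> g) |` S \<in> groupoid"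
  using G_object[of g S] unfolding conj_groupoid_def hom_set_def by blast

lemma dom_object: "\<phi> \<in> groupoid \<Longrightarrow> dom \<phi> \<in> objects"
  and ran_object: "\<phi> \<in> groupoid \<Longrightarrow> ran \<phi> \<in> objects"
  by (erule groupoidE, simp, erule groupoidE, simp add: G_object)

lemma object_closed:
  assumes "S \<in> objects"
  shows "x \<in> S \<Longrightarrow> x \<in> carrier \<Omega>" "\<zero> \<in> S" "\<one> \<in> S" "x \<in> S \<Longrightarrow> \<ominus> x \<in> S"
    "x \<in> S \<Longrightarrow> y \<in> S \<Longrightarrow> x \<otimes> y \<in> S" "x \<in> S \<Longrightarrow> y \<in> S \<Longrightarrow> x \<oplus> y \<in> S"
    "k \<in> K \<Longrightarrow> k \<in> S" "x \<in> S \<Longrightarrow> x \<noteq> \<zero> \<Longrightarrow> inv x \<in> S"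
  using subringE[OF subfieldE(1)[OF object_subfield[OF assms]]] object_subset(2)[OF assms]
    subfield_m_inv(1)[OF object_subfield[OF assms]]
  by auto

text \<open>On its domain \<phi> agrees with an automorphism in \<open>G\<close>, and all the laws
  come from there. Injectivity is what later keeps transported nonzero coefficients nonzero.\<close>

lemma act_hom:
  assumes "\<phi> \<in> groupoid"
  shows "x \<in> dom \<phi> \<Longrightarrow> act \<phi> x \<in> ran \<phi>"
    "x \<in> dom \<phi> \<Longrightarrow> y \<in> dom \<phi> \<Longrightarrow> act \<phi> (x \<otimes> y) = act \<phi> x \<otimes> act \<phi> y"
    "x \<in> dom \<phi> \<Longrightarrow> y \<in> dom \<phi> \<Longrightarrow> act \<phi> (x \<oplus> y) = act \<phi> x \<oplus> act \<phi> y"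
    "k \<in> K \<Longrightarrow> act \<phi> k = k" "act \<phi> \<zero> = \<zero>" "act \<phi> \<one> = \<one>"
    "x \<in> dom \<phi> \<Longrightarrow> y \<in> dom \<phi> \<Longrightarrow> act \<phi> x = act \<phi> y \<Longrightarrow> x = y"
proof -
  obtain g S where g: "g \<in> G" "S \<in> objects" "\<phi> = (Some \<circ> g) |` S" "dom \<phi> = S" "ran \<phi> = g ` S"
    using assms by (rule groupoidE)
  have act: "act \<phi> x = g x" if "x \<in> S" for x
    using that g(3) by simp
  note cl = object_closed[OF g(2)] object_subset[OF g(2)]
  note iso = ring_iso_memE[OF G_iso[OF g(1)], simplified]
  show "x \<in> dom \<phi> \<Longrightarrow> act \<phi> x \<in> ran \<phi>"
    using act g by auto
  show "x \<in> dom \<phi> \<Longrightarrow> y \<in> dom \<phi> \<Longrightarrow> act \<phi> (x \<otimes> y) = act \<phi> x \<otimes> act \<phi> y"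
    using act iso(2) g(4) cl by (metis subsetD)
  show "x \<in> dom \<phi> \<Longrightarrow> y \<in> dom \<phi> \<Longrightarrow> act \<phi> (x \<oplus> y) = act \<phi> x \<oplus> act \<phi> y"
    using act iso(3) g(4) cl by (metis subsetD)
  show fixK: "k \<in> K \<Longrightarrow> act \<phi> k = k" for k
    using act cl G_fixes[OF g(1)] by auto
  \<comment> \<open>Both constants lie in \<open>K\<close>, which is fixed pointwise.\<close>
  show "act \<phi> \<zero> = \<zero>" "act \<phi> \<one> = \<one>"
    using fixK subringE(2,3)[OF subfieldE(1)[OF subfield_K]] by auto
  show "x \<in> dom \<phi> \<Longrightarrow> y \<in> dom \<phi> \<Longrightarrow> act \<phi> x = act \<phi> y \<Longrightarrow> x = y"
    using act iso(5) g(4) cl by (metis bij_betw_imp_inj_on inj_onD subsetD)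
qed

lemma id_map_dom [simp]: "dom (id_map S) = S"
  by (simp add: id_map_def)

lemma id_map_ran [simp]: "ran (id_map S) = S"
  by (auto simp: id_map_def restrict_map_def ran_def)

lemma act_id_map: "x \<in> S \<Longrightarrow> act (id_map S) x = x"
  by (simp add: id_map_def)

lemma id_map_groupoid:
  assumes "S \<in> objects" shows "id_map S \<in> groupoid"
proof -
  have "id_map S = (Some \<circ> restrict id N) |` S"
    unfolding id_map_eq using object_subset(1)[OF assms] by (intro Some_restrict_cong) auto
  then show ?thesis by (simp only: groupoidI[OF G_id assms])
qed

lemma L_object: "L \<in> objects"
proof -
  have "restrict id N ` L = id ` L"
    by (rule image_cong) (use L_subset in auto)
  then have "L = (\<lambda>g. g ` L) (restrict id N)" by simp
  then show ?thesis unfolding conjugate_fields_def using G_id by (rule image_eqI)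
qed

section \<open>Composition, inverses and connectedness\<close>

lemma comp_dom:
  assumes "composable \<phi> \<psi>" shows "dom (\<phi> \<circ>\<^sub>m \<psi>) = dom \<psi>"
proof -
  have "\<exists>z. \<phi> y = Some z" if "\<psi> x = Some y" for x y
    using ranI[of \<psi>, OF that] assms by (auto simp: composable_def)
  then show ?thesis by (auto simp: map_comp_def dom_def split: option.splits)
qed

text \<open>The inclusion of \<open>ran \<phi>\<close> uses the equality in
  \<open>composable\<close>: every point where \<phi> is defined is a value of \<psi>.\<close>

lemma comp_ran:
  assumes "composable \<phi> \<psi>" shows "ran (\<phi> \<circ>\<^sub>m \<psi>) = ran \<phi>"
proof
  show "ran (\<phi> \<circ>\<^sub>m \<psi>) \<subseteq> ran \<phi>"
    by (auto simp: ran_def map_comp_def split: option.splits)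
  show "ran \<phi> \<subseteq> ran (\<phi> \<circ>\<^sub>m \<psi>)"
  proof
    fix z assume "z \<in> ran \<phi>"
    then obtain y where y: "\<phi> y = Some z" by (auto simp: ran_def)
    then have "y \<in> ran \<psi>" using assms by (auto simp: composable_def)
    then obtain x where "\<psi> x = Some y" by (auto simp: ran_def)
    with y have "(\<phi> \<circ>\<^sub>m \<psi>) x = Some z" by simp
    then show "z \<in> ran (\<phi> \<circ>\<^sub>m \<psi>)" by (rule ranI)
  qed
qed

lemma act_comp: "x \<in> dom \<psi> \<Longrightarrow> act (\<phi> \<circ>\<^sub>m \<psi>) x = act \<phi> (act \<psi> x)"
  by (auto simp: map_comp_def)

lemma comp_groupoid:
  assumes "\<phi> \<in> groupoid" "\<psi> \<in> groupoid" "composable \<phi> \<psi>"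
  shows "\<phi> \<circ>\<^sub>m \<psi> \<in> groupoid"
proof -
  obtain g S where g: "g \<in> G" "S \<in> objects" "\<phi> = (Some \<circ> g) |` S" "dom \<phi> = S" "ran \<phi> = g ` S"
    using assms(1) by (rule groupoidE)
  obtain h T where h: "h \<in> G" "T \<in> objects" "\<psi> = (Some \<circ> h) |` T" "dom \<psi> = T" "ran \<psi> = h ` T"
    using assms(2) by (rule groupoidE)
  have "S = h ` T" using assms(3) g(4) h(5) by (simp add: composable_def)
  then have "\<phi> \<circ>\<^sub>m \<psi> = (Some \<circ> (g \<circ> h)) |` T"
    using Some_restrict_comp g(3) h(3) by simp
  also have "\<dots> = (Some \<circ> restrict (g \<circ> h) N) |` T"
    using object_subset(1)[OF h(2)] by (intro Some_restrict_cong) auto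
  finally show ?thesis using groupoidI[OF G_comp[OF g(1) h(1)] h(2)] by simp
qed

lemma comp_assoc: "(\<phi> \<circ>\<^sub>m \<psi>) \<circ>\<^sub>m \<chi> = \<phi> \<circ>\<^sub>m (\<psi> \<circ>\<^sub>m \<chi>)"
  by (auto simp: map_comp_def fun_eq_iff split: option.splits)

lemma id_comp: "ran \<phi> = S \<Longrightarrow> id_map S \<circ>\<^sub>m \<phi> = \<phi>"
  and comp_id: "dom \<phi> = S \<Longrightarrow> \<phi> \<circ>\<^sub>m id_map S = \<phi>"
  by (auto simp: map_comp_def id_map_def restrict_map_def fun_eq_iff dom_def
      split: option.splits intro: ranI)

text \<open>If \<phi> is the restriction of \<open>g\<close>, its inverse is the inverse
  automorphism of \<open>N\<close> restricted to \<open>ran \<phi>\<close>. The computation stays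
  inside \<open>N\<close>, where \<open>g\<close> is injective.\<close>

lemma groupoid_inverse:
  assumes "\<phi> \<in> groupoid"
  obtains \<psi> where "\<psi> \<in> groupoid" "dom \<psi> = ran \<phi>" "ran \<psi> = dom \<phi>"
    "\<phi> \<circ>\<^sub>m \<psi> = id_map (ran \<phi>)" "\<psi> \<circ>\<^sub>m \<phi> = id_map (dom \<phi>)"
proof -
  obtain g S where g: "g \<in> G" "S \<in> objects" "\<phi> = (Some \<circ> g) |` S" "dom \<phi> = S" "ran \<phi> = g ` S"
    using assms by (rule groupoidE)
  let ?g' = "restrict (inv_into N g) N"
  let ?\<psi> = "(Some \<circ> ?g') |` ran \<phi>"
  have inj: "inj_on g N" using G_bij[OF g(1)] by (rule bij_betw_imp_inj_on)
  have SN: "S \<subseteq> N" "g ` S \<subseteq> N"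
    using object_subset(1) g(2) G_object[OF g(1,2)] by auto
  have inv: "?g' (g x) = x" if "x \<in> S" for x
    using that SN inj by (auto simp: inv_into_f_f)
  have "?\<psi> \<in> groupoid"
    using groupoidI[OF G_inv[OF g(1)] ran_object[OF assms]] .
  moreover have "dom ?\<psi> = ran \<phi>" by (rule dom_Some_restrict)
  moreover have "ran ?\<psi> = dom \<phi>"
    unfolding g(4,5) ran_Some_restrict image_image by (simp only: inv image_ident cong: image_cong)
  moreover have "?\<psi> \<circ>\<^sub>m \<phi> = id_map (dom \<phi>)"
    unfolding g(3) id_map_eq dom_Some_restrict ran_Some_restrict Some_restrict_comp
    by (rule Some_restrict_cong) (simp only: o_apply inv)
  moreover have "\<phi> \<circ>\<^sub>m ?\<psi> = id_map (ran \<phi>)"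
  proof -
    have "\<phi> \<circ>\<^sub>m ?\<psi> = (Some \<circ> (g \<circ> ?g')) |` (g ` S)"
      using Some_restrict_comp[of g ?g' "g ` S"] unfolding g(3) ran_Some_restrict image_image
      by (simp only: inv image_ident cong: image_cong)
    also have "\<dots> = id_map (g ` S)"
      unfolding id_map_eq
    proof (rule Some_restrict_cong)
      fix y assume "y \<in> g ` S"
      then obtain x where "x \<in> S" "y = g x" by blast
      then show "(g \<circ> ?g') y = y" by (simp only: o_apply inv)
    qed
    finally show ?thesis unfolding g(5) .
  qed
  ultimately show thesis using that by blast
qed

text \<open>Every object is a conjugate of \<open>L\<close>, so two objects are joined by going back
  to \<open>L\<close> along an inverse and out again.\<close>

lemma groupoid_connected:
  assumes "S \<in> objects" "T \<in> objects"
  obtains \<phi> where "\<phi> \<in> groupoid" "dom \<phi> = S" "ran \<phi> = T"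
proof -
  have from_L: "\<exists>\<phi>\<in>groupoid. dom \<phi> = L \<and> ran \<phi> = S" if "S \<in> objects" for S
  proof -
    obtain g where g: "g \<in> G" "S = g ` L" using \<open>S \<in> objects\<close> by (rule objectsE)
    have "dom ((Some \<circ> g) |` L) = L" "ran ((Some \<circ> g) |` L) = S"
      by (simp_all only: g(2) dom_Some_restrict ran_Some_restrict)
    then show ?thesis using groupoidI[OF g(1) L_object] by blast
  qed
  obtain \<phi> \<psi> where \<phi>: "\<phi> \<in> groupoid" "dom \<phi> = L" "ran \<phi> = S"
    and \<psi>: "\<psi> \<in> groupoid" "dom \<psi> = L" "ran \<psi> = T"
    using from_L assms by meson
  obtain \<phi>' where \<phi>': "\<phi>' \<in> groupoid" "dom \<phi>' = S" "ran \<phi>' = L"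
    using groupoid_inverse[OF \<phi>(1)] \<phi> by metis
  have "composable \<psi> \<phi>'" using \<psi> \<phi>' by (simp add: composable_def)
  then show thesis
    using that[of "\<psi> \<circ>\<^sub>m \<phi>'"] comp_groupoid comp_dom comp_ran \<psi> \<phi>' by metis
qed

text \<open>Composing with the inverse of \<psi> removes it. This makes the left factor of a
  factorization unique once the right factor is prescribed.\<close>

lemma comp_right_cancel:
  assumes "\<psi> \<in> groupoid" "composable \<phi> \<psi>" "composable \<phi>' \<psi>" "\<phi> \<circ>\<^sub>m \<psi> = \<phi>' \<circ>\<^sub>m \<psi>"
  shows "\<phi> = \<phi>'"
proof -
  obtain \<psi>' where "\<psi> \<circ>\<^sub>m \<psi>' = id_map (ran \<psi>)" using groupoid_inverse[OF assms(1)] by metis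
  then show ?thesis using assms(2-4) comp_assoc comp_id unfolding composable_def by metis
qed

text \<open>This is how an element is recognized as an identity after coefficients of commuting
  products have been compared.\<close>

lemma id_mapI:
  assumes "\<And>x. x \<in> dom \<phi> \<Longrightarrow> act \<phi> x = x"
  shows "\<phi> = id_map (dom \<phi>)"
proof
  fix x show "\<phi> x = id_map (dom \<phi>) x"
    using assms[of x] by (cases "\<phi> x") (auto simp: id_map_def restrict_map_def)
qed

text \<open>The groupoid elements from \<open>L\<close> to \<open>L\<close> are exactly the
  restrictions of those \<open>g\<close> in \<open>G\<close> that map \<open>L\<close> onto itself.
  In this form invariance can be matched with the transport relation for central elements.\<close>

lemma fixed_elements_eq:
  "fixed_elements G L =
    {c \<in> L. \<forall>\<phi>\<in>groupoid. dom \<phi> = L \<longrightarrow> ran \<phi> = L \<longrightarrow> act \<phi> c = c}"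
proof -
  have "(\<forall>g\<in>G. g ` L = L \<longrightarrow> g c = c) \<longleftrightarrow>
    (\<forall>\<phi>\<in>groupoid. dom \<phi> = L \<longrightarrow> ran \<phi> = L \<longrightarrow> act \<phi> c = c)" if c: "c \<in> L" for c
  proof (intro iffI ballI impI)
    fix g assume *: "\<forall>\<phi>\<in>groupoid. dom \<phi> = L \<longrightarrow> ran \<phi> = L \<longrightarrow> act \<phi> c = c" "g \<in> G" "g ` L = L"
    have "dom ((Some \<circ> g) |` L) = L" "ran ((Some \<circ> g) |` L) = L"
      by (simp_all only: dom_Some_restrict ran_Some_restrict *(3))
    then have "act ((Some \<circ> g) |` L) c = c" using *(1) groupoidI[OF *(2) L_object] by blast
    then show "g c = c" using c by simp
  next
    fix \<phi> assume *: "\<forall>g\<in>G. g ` L = L \<longrightarrow> g c = c" "\<phi> \<in> groupoid" "dom \<phi> = L" "ran \<phi> = L"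
    from *(2) obtain g S where "g \<in> G" "\<phi> = (Some \<circ> g) |` S" "dom \<phi> = S" "ran \<phi> = g ` S"
      by (rule groupoidE)
    then show "act \<phi> c = c" using * c by auto
  qed
  then show ?thesis by (auto simp: fixed_elements_def)
qed

end

subsection \<open>The crossed product as an algebra\<close>

locale galois_object_crossed_product = galois_conjugates +
  fixes \<beta> :: "('a \<rightharpoonup> 'a) \<Rightarrow> ('a \<rightharpoonup> 'a) \<Rightarrow> 'a"
  assumes cocycle: "cocycle \<Omega> (conj_groupoid G L) \<beta>"
begin

abbreviation A :: "('a, ('a \<rightharpoonup> 'a) \<Rightarrow> 'a) module" where
  "A \<equiv> crossed_product \<Omega> G L \<beta>"

text \<open>The monomial \<open>a u\<^sub>\<phi>\<close>.\<close>

definition single :: "'a \<Rightarrow> ('a \<rightharpoonup> 'a) \<Rightarrow> ('a \<rightharpoonup> 'a) \<Rightarrow> 'a" where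
  "single a \<phi> = (\<lambda>\<chi>. if \<chi> = \<phi> then a else \<zero>)"

definition prod_term ::
  "(('a \<rightharpoonup> 'a) \<Rightarrow> 'a) \<Rightarrow> (('a \<rightharpoonup> 'a) \<Rightarrow> 'a) \<Rightarrow> ('a \<rightharpoonup> 'a) \<times> ('a \<rightharpoonup> 'a) \<Rightarrow> 'a" where
  "prod_term f h = (\<lambda>(\<phi>, \<psi>). f \<phi> \<otimes> act \<phi> (h \<psi>) \<otimes> \<beta> \<phi> \<psi>)"

text \<open>\<open>S\<close> and \<open>T\<close> are parameters instead of the two supports, so
  that several products can be summed over one common index set.\<close>

definition factorizations ::
  "('a \<rightharpoonup> 'a) \<Rightarrow> ('a \<rightharpoonup> 'a) set \<Rightarrow> ('a \<rightharpoonup> 'a) set \<Rightarrow> (('a \<rightharpoonup> 'a) \<times> ('a \<rightharpoonup> 'a)) set" where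
  "factorizations \<chi> S T = {(\<phi>, \<psi>) \<in> S \<times> T. composable \<phi> \<psi> \<and> \<phi> \<circ>\<^sub>m \<psi> = \<chi>}"

lemmas ran_closed = object_closed[OF ran_object]

lemma act_composable:
  "\<phi> \<in> groupoid \<Longrightarrow> composable \<phi> \<psi> \<Longrightarrow> x \<in> ran \<psi> \<Longrightarrow> act \<phi> x \<in> ran \<phi>"
  using act_hom(1) by (simp add: composable_def)

lemma cocycle_closed:
  assumes "\<phi> \<in> groupoid" "\<psi> \<in> groupoid" "composable \<phi> \<psi>"
  shows "\<beta> \<phi> \<psi> \<in> ran \<phi>" "\<beta> \<phi> \<psi> \<noteq> \<zero>"
  using cocycle assms unfolding cocycle_def by auto

lemma cocycle_id:
  assumes "\<phi> \<in> groupoid"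
  shows "dom \<phi> = S \<Longrightarrow> \<beta> \<phi> (id_map S) = \<one>" "ran \<phi> = S \<Longrightarrow> \<beta> (id_map S) \<phi> = \<one>"
  using cocycle assms unfolding cocycle_def by auto

lemma cocycle_eq:
  assumes "\<phi> \<in> groupoid" "\<psi> \<in> groupoid" "\<chi> \<in> groupoid" "composable \<phi> \<psi>" "composable \<psi> \<chi>"
  shows "\<beta> \<phi> \<psi> \<otimes> \<beta> (\<phi> \<circ>\<^sub>m \<psi>) \<chi> = act \<phi> (\<beta> \<psi> \<chi>) \<otimes> \<beta> \<phi> (\<psi> \<circ>\<^sub>m \<chi>)"
  using cocycle assms unfolding cocycle_def by blast

lemma carrier_iff:
  "f \<in> carrier A \<longleftrightarrow> (\<forall>\<phi>\<in>groupoid. f \<phi> \<in> ran \<phi>) \<and> support \<Omega> f \<subseteq> groupoid \<and> finite (support \<Omega> f)"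
  by (simp add: crossed_product_def)

lemma carrierD:
  assumes "f \<in> carrier A"
  shows "\<phi> \<in> groupoid \<Longrightarrow> f \<phi> \<in> ran \<phi>" "\<phi> \<notin> groupoid \<Longrightarrow> f \<phi> = \<zero>"
    "finite (support \<Omega> f)" "support \<Omega> f \<subseteq> groupoid"
  using assms unfolding carrier_iff by (auto simp: support_def)

lemma carrierI:
  assumes "\<And>\<phi>. \<phi> \<in> groupoid \<Longrightarrow> f \<phi> \<in> ran \<phi>" "support \<Omega> f \<subseteq> S" "finite S" "S \<subseteq> groupoid"
  shows "f \<in> carrier A"
  unfolding carrier_iff using assms finite_subset[of _ S] by auto

lemma carrier_closed: "f \<in> carrier A \<Longrightarrow> f \<phi> \<in> carrier \<Omega>"
  using carrierD(1,2)[of f \<phi>] ran_closed(1)[of \<phi>] zero_closed by metis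

lemma A_add: "f \<oplus>\<^bsub>A\<^esub> h = (\<lambda>\<phi>. f \<phi> \<oplus> h \<phi>)"
  and A_zero: "\<zero>\<^bsub>A\<^esub> = (\<lambda>_. \<zero>)"
  and A_smult: "k \<odot>\<^bsub>A\<^esub> f = (\<lambda>\<phi>. k \<otimes> f \<phi>)"
  and A_mult: "(f \<otimes>\<^bsub>A\<^esub> h) \<chi> =
    finsum \<Omega> (prod_term f h) (factorizations \<chi> (support \<Omega> f) (support \<Omega> h))"
  by (simp_all add: crossed_product_def prod_term_def factorizations_def)

section \<open>Coefficients of products\<close>

lemma prod_term_closed:
  assumes "f \<in> carrier A" "h \<in> carrier A" "\<phi> \<in> groupoid" "\<psi> \<in> groupoid" "composable \<phi> \<psi>"
  shows "f \<phi> \<otimes> act \<phi> (h \<psi>) \<otimes> \<beta> \<phi> \<psi> \<in> ran \<phi>"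
  using assms by (simp add: ran_closed act_composable carrierD cocycle_closed)

lemma prod_term_Pi:
  assumes "f \<in> carrier A" "h \<in> carrier A" "S \<subseteq> groupoid" "T \<subseteq> groupoid"
  shows "prod_term f h \<in> factorizations \<chi> S T \<rightarrow> carrier \<Omega>"
  using prod_term_closed[OF assms(1,2)] assms(3,4) ran_closed(1)
  by (auto simp: prod_term_def factorizations_def subset_iff)

lemma factorizationsE:
  assumes "p \<in> factorizations \<chi> S T" "S \<subseteq> groupoid" "T \<subseteq> groupoid"
  obtains \<phi> \<psi> where "p = (\<phi>, \<psi>)" "\<phi> \<in> groupoid" "\<psi> \<in> groupoid"
    "composable \<phi> \<psi>" "\<phi> \<circ>\<^sub>m \<psi> = \<chi>"
proof -
  obtain \<phi> \<psi> where *: "p = (\<phi>, \<psi>)" "\<phi> \<in> S" "\<psi> \<in> T" "composable \<phi> \<psi>" "\<phi> \<circ>\<^sub>m \<psi> = \<chi>"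
    using assms(1) by (auto simp: factorizations_def)
  show thesis
    by (rule that[OF *(1) subsetD[OF assms(2) *(2)] subsetD[OF assms(3) *(3)] *(4,5)])
qed

lemma finite_factorizations: "finite S \<Longrightarrow> finite T \<Longrightarrow> finite (factorizations \<chi> S T)"
  by (rule finite_subset[of _ "S \<times> T"]) (auto simp: factorizations_def)

text \<open>A zero right coefficient survives the action as zero because \<phi> preserves zero. The
  lemma serves to add or drop terms outside the supports.\<close>

lemma prod_term_eq_zero:
  assumes "f \<in> carrier A" "h \<in> carrier A" "\<phi> \<in> groupoid" "\<psi> \<in> groupoid" "composable \<phi> \<psi>"
    "f \<phi> = \<zero> \<or> h \<psi> = \<zero>"
  shows "f \<phi> \<otimes> act \<phi> (h \<psi>) \<otimes> \<beta> \<phi> \<psi> = \<zero>"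
proof -
  have "f \<phi> \<in> carrier \<Omega>" "act \<phi> (h \<psi>) \<in> carrier \<Omega>" "\<beta> \<phi> \<psi> \<in> carrier \<Omega>"
    using assms ran_closed(1)[OF assms(3)] act_composable carrierD(1) cocycle_closed(1) by blast+
  then show ?thesis using assms(6) act_hom(5)[OF assms(3)] by auto
qed

text \<open>Enlarging the index sets adds only zero terms. Thus two elements and their sum, whose
  support can shrink by cancellation, are handled over the same pairs.\<close>

lemma mult_superset:
  assumes "f \<in> carrier A" "h \<in> carrier A"
    and "finite S" "support \<Omega> f \<subseteq> S" "S \<subseteq> groupoid"
    and "finite T" "support \<Omega> h \<subseteq> T" "T \<subseteq> groupoid"
  shows "(f \<otimes>\<^bsub>A\<^esub> h) \<chi> = finsum \<Omega> (prod_term f h) (factorizations \<chi> S T)"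
  unfolding A_mult
proof (rule add.finprod_mono_neutral_cong_left)
  show "finite (factorizations \<chi> S T)" using assms finite_factorizations by blast
  show "factorizations \<chi> (support \<Omega> f) (support \<Omega> h) \<subseteq> factorizations \<chi> S T"
    using assms by (auto simp: factorizations_def)
  show "prod_term f h \<in> factorizations \<chi> S T \<rightarrow> carrier \<Omega>"
    using prod_term_Pi assms by blast
  fix p assume p: "p \<in> factorizations \<chi> S T - factorizations \<chi> (support \<Omega> f) (support \<Omega> h)"
  then obtain \<phi> \<psi> where "p = (\<phi>, \<psi>)" "\<phi> \<in> S" "\<psi> \<in> T" "composable \<phi> \<psi>" "f \<phi> = \<zero> \<or> h \<psi> = \<zero>"
    by (auto simp: factorizations_def support_def)
  then show "prod_term f h p = \<zero>"
    using prod_term_eq_zero[OF assms(1,2)] assms(5,8) by (auto simp: prod_term_def)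
qed simp

lemma finsum_object:
  assumes "S \<in> objects" "finite J" "\<And>x. x \<in> J \<Longrightarrow> t x \<in> S"
  shows "finsum \<Omega> t J \<in> S"
  using assms(2,3)
proof (induction J rule: finite_induct)
  case empty
  then show ?case using object_closed(2)[OF assms(1)] by simp
next
  case (insert x J)
  then have "finsum \<Omega> t (insert x J) = t x \<oplus> finsum \<Omega> t J"
    using object_closed(1)[OF assms(1)] by (intro finsum_insert) auto
  then show ?case using insert object_closed(6)[OF assms(1)] by simp
qed

text \<open>A nonzero coefficient needs a factorization, so the support lies in the finite set of
  composites. A term at \<open>\<phi> \<circ>\<^sub>m \<psi>\<close> lies in
  \<open>ran \<phi>\<close>, which is also the range of the composite.\<close>

lemma A_mult_closed:
  assumes "f \<in> carrier A" "h \<in> carrier A"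
  shows "f \<otimes>\<^bsub>A\<^esub> h \<in> carrier A"
proof (rule carrierI)
  note f = carrierD[OF assms(1)] and h = carrierD[OF assms(2)]
  let ?S = "(\<lambda>(\<phi>, \<psi>). \<phi> \<circ>\<^sub>m \<psi>) ` {(\<phi>, \<psi>) \<in> support \<Omega> f \<times> support \<Omega> h. composable \<phi> \<psi>}"
  have "finite {(\<phi>, \<psi>) \<in> support \<Omega> f \<times> support \<Omega> h. composable \<phi> \<psi>}"
    by (rule finite_subset[OF _ finite_cartesian_product[OF f(3) h(3)]]) auto
  then show "finite ?S" by (rule finite_imageI)
  show "?S \<subseteq> groupoid" using f(4) h(4) comp_groupoid by auto
  show "support \<Omega> (f \<otimes>\<^bsub>A\<^esub> h) \<subseteq> ?S"
  proof
    fix \<chi> assume "\<chi> \<in> support \<Omega> (f \<otimes>\<^bsub>A\<^esub> h)"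
    then have "factorizations \<chi> (support \<Omega> f) (support \<Omega> h) \<noteq> {}"
      by (auto simp: support_def A_mult)
    then show "\<chi> \<in> ?S" by (force simp: factorizations_def)
  qed
  fix \<chi> assume "\<chi> \<in> groupoid"
  show "(f \<otimes>\<^bsub>A\<^esub> h) \<chi> \<in> ran \<chi>"
    unfolding A_mult
  proof (rule finsum_object)
    show "ran \<chi> \<in> objects" using \<open>\<chi> \<in> groupoid\<close> by (rule ran_object)
    show "finite (factorizations \<chi> (support \<Omega> f) (support \<Omega> h))"
      using f h finite_factorizations by blast
    fix p assume p: "p \<in> factorizations \<chi> (support \<Omega> f) (support \<Omega> h)"
    obtain \<phi> \<psi> where p: "p = (\<phi>, \<psi>)" "\<phi> \<in> groupoid" "\<psi> \<in> groupoid" "composable \<phi> \<psi>" "\<phi> \<circ>\<^sub>m \<psi> = \<chi>"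
      by (rule factorizationsE[OF p f(4) h(4)])
    then show "prod_term f h p \<in> ran \<chi>"
      using prod_term_closed[OF assms p(2-4)] comp_ran[OF p(4)] by (simp add: prod_term_def)
  qed
qed

section \<open>Additive structure, distributivity and scalars\<close>

lemma A_zero_closed: "\<zero>\<^bsub>A\<^esub> \<in> carrier A"
  unfolding carrier_iff by (simp add: A_zero ran_closed support_def)

lemma A_add_closed:
  assumes "f \<in> carrier A" "h \<in> carrier A" shows "f \<oplus>\<^bsub>A\<^esub> h \<in> carrier A"
proof (rule carrierI)
  show "support \<Omega> (f \<oplus>\<^bsub>A\<^esub> h) \<subseteq> support \<Omega> f \<union> support \<Omega> h"
    by (auto simp: support_def A_add)
qed (use carrierD[OF assms(1)] carrierD[OF assms(2)] ran_closed in \<open>auto simp: A_add\<close>)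

lemma A_smult_closed:
  assumes "k \<in> K" "f \<in> carrier A" shows "k \<odot>\<^bsub>A\<^esub> f \<in> carrier A"
proof (rule carrierI)
  have "k \<in> carrier \<Omega>" using assms(1) subfieldE(3)[OF subfield_K] by auto
  then show "support \<Omega> (k \<odot>\<^bsub>A\<^esub> f) \<subseteq> support \<Omega> f"
    by (auto simp: support_def A_smult)
qed (use carrierD[OF assms(2)] ran_closed assms(1) in \<open>auto simp: A_smult\<close>)

lemma A_abelian_group: "abelian_group A"
proof (rule abelian_groupI)
  fix f g h assume *: "f \<in> carrier A" "g \<in> carrier A" "h \<in> carrier A"
  show "(f \<oplus>\<^bsub>A\<^esub> g) \<oplus>\<^bsub>A\<^esub> h = f \<oplus>\<^bsub>A\<^esub> (g \<oplus>\<^bsub>A\<^esub> h)"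
    using * carrier_closed by (auto simp: A_add a_assoc)
next
  fix f g assume "f \<in> carrier A" "g \<in> carrier A"
  then show "f \<oplus>\<^bsub>A\<^esub> g = g \<oplus>\<^bsub>A\<^esub> f"
    using carrier_closed by (auto simp: A_add a_comm)
next
  fix f assume f: "f \<in> carrier A"
  then show "\<zero>\<^bsub>A\<^esub> \<oplus>\<^bsub>A\<^esub> f = f"
    using carrier_closed by (auto simp: A_add A_zero)
  have "(\<lambda>\<phi>. \<ominus> f \<phi>) \<in> carrier A"
    using carrierD[OF f] ran_closed by (intro carrierI[of _ "support \<Omega> f"]) (auto simp: support_def)
  moreover have "(\<lambda>\<phi>. \<ominus> f \<phi>) \<oplus>\<^bsub>A\<^esub> f = \<zero>\<^bsub>A\<^esub>"
    using carrier_closed[OF f] by (simp add: A_add A_zero l_neg)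
  ultimately show "\<exists>g\<in>carrier A. g \<oplus>\<^bsub>A\<^esub> f = \<zero>\<^bsub>A\<^esub>" by blast
qed (auto intro: A_add_closed A_zero_closed)

text \<open>The sums are compared term by term over the union of the supports of \<open>f\<close>
  and \<open>g\<close>.\<close>

lemma A_l_distr:
  assumes "f \<in> carrier A" "g \<in> carrier A" "h \<in> carrier A"
  shows "(f \<oplus>\<^bsub>A\<^esub> g) \<otimes>\<^bsub>A\<^esub> h = f \<otimes>\<^bsub>A\<^esub> h \<oplus>\<^bsub>A\<^esub> g \<otimes>\<^bsub>A\<^esub> h"
proof
  fix \<chi>
  let ?S = "support \<Omega> f \<union> support \<Omega> g" and ?T = "support \<Omega> h"
  note f = carrierD[OF assms(1)] and g = carrierD[OF assms(2)] and h = carrierD[OF assms(3)]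
  have S: "finite ?S" "?S \<subseteq> groupoid" "support \<Omega> f \<subseteq> ?S" "support \<Omega> g \<subseteq> ?S"
    "support \<Omega> (f \<oplus>\<^bsub>A\<^esub> g) \<subseteq> ?S"
    using f g by (auto simp: support_def A_add)
  note Pi = prod_term_Pi[OF _ assms(3) S(2) h(4), of _ \<chi>]
  have "((f \<oplus>\<^bsub>A\<^esub> g) \<otimes>\<^bsub>A\<^esub> h) \<chi> = finsum \<Omega> (prod_term (f \<oplus>\<^bsub>A\<^esub> g) h) (factorizations \<chi> ?S ?T)"
    by (rule mult_superset[OF A_add_closed[OF assms(1,2)] assms(3) S(1,5,2) h(3) subset_refl h(4)])
  also have "\<dots> = finsum \<Omega> (\<lambda>p. prod_term f h p \<oplus> prod_term g h p) (factorizations \<chi> ?S ?T)"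
  proof (rule finsum_cong')
    show "(\<lambda>p. prod_term f h p \<oplus> prod_term g h p) \<in> factorizations \<chi> ?S ?T \<rightarrow> carrier \<Omega>"
      using Pi[OF assms(1)] Pi[OF assms(2)] by auto
    fix p assume p: "p \<in> factorizations \<chi> ?S ?T"
    obtain \<phi> \<psi> where p: "p = (\<phi>, \<psi>)" "\<phi> \<in> groupoid" "\<psi> \<in> groupoid" "composable \<phi> \<psi>"
      by (rule factorizationsE[OF p S(2) h(4)])
    have "act \<phi> (h \<psi>) \<in> carrier \<Omega>" "\<beta> \<phi> \<psi> \<in> carrier \<Omega>"
      using p act_composable cocycle_closed(1) h(1) ran_closed(1) by blast+
    then show "prod_term (f \<oplus>\<^bsub>A\<^esub> g) h p = prod_term f h p \<oplus> prod_term g h p"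
      using carrier_closed assms by (simp add: p(1) prod_term_def A_add l_distr)
  qed simp
  also have "\<dots> = finsum \<Omega> (prod_term f h) (factorizations \<chi> ?S ?T) \<oplus>
      finsum \<Omega> (prod_term g h) (factorizations \<chi> ?S ?T)"
    by (intro finsum_addf Pi assms)
  also have "\<dots> = (f \<otimes>\<^bsub>A\<^esub> h) \<chi> \<oplus> (g \<otimes>\<^bsub>A\<^esub> h) \<chi>"
    by (simp only: mult_superset[OF assms(1,3) S(1,3,2) h(3) subset_refl h(4)]
        mult_superset[OF assms(2,3) S(1,4,2) h(3) subset_refl h(4)])
  finally show "((f \<oplus>\<^bsub>A\<^esub> g) \<otimes>\<^bsub>A\<^esub> h) \<chi> = (f \<otimes>\<^bsub>A\<^esub> h \<oplus>\<^bsub>A\<^esub> g \<otimes>\<^bsub>A\<^esub> h) \<chi>"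
    by (simp add: A_add)
qed

lemma A_r_distr:
  assumes "f \<in> carrier A" "g \<in> carrier A" "h \<in> carrier A"
  shows "h \<otimes>\<^bsub>A\<^esub> (f \<oplus>\<^bsub>A\<^esub> g) = h \<otimes>\<^bsub>A\<^esub> f \<oplus>\<^bsub>A\<^esub> h \<otimes>\<^bsub>A\<^esub> g"
proof
  fix \<chi>
  let ?S = "support \<Omega> f \<union> support \<Omega> g" and ?T = "support \<Omega> h"
  note f = carrierD[OF assms(1)] and g = carrierD[OF assms(2)] and h = carrierD[OF assms(3)]
  have S: "finite ?S" "?S \<subseteq> groupoid" "support \<Omega> f \<subseteq> ?S" "support \<Omega> g \<subseteq> ?S"
    "support \<Omega> (f \<oplus>\<^bsub>A\<^esub> g) \<subseteq> ?S"
    using f g by (auto simp: support_def A_add)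
  note Pi = prod_term_Pi[OF assms(3) _ h(4) S(2), of _ \<chi>]
  have "(h \<otimes>\<^bsub>A\<^esub> (f \<oplus>\<^bsub>A\<^esub> g)) \<chi> = finsum \<Omega> (prod_term h (f \<oplus>\<^bsub>A\<^esub> g)) (factorizations \<chi> ?T ?S)"
    by (rule mult_superset[OF assms(3) A_add_closed[OF assms(1,2)] h(3) subset_refl h(4) S(1,5,2)])
  also have "\<dots> = finsum \<Omega> (\<lambda>p. prod_term h f p \<oplus> prod_term h g p) (factorizations \<chi> ?T ?S)"
  proof (rule finsum_cong')
    show "(\<lambda>p. prod_term h f p \<oplus> prod_term h g p) \<in> factorizations \<chi> ?T ?S \<rightarrow> carrier \<Omega>"
      using Pi[OF assms(1)] Pi[OF assms(2)] by auto
    fix p assume p: "p \<in> factorizations \<chi> ?T ?S"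
    obtain \<phi> \<psi> where p: "p = (\<phi>, \<psi>)" "\<phi> \<in> groupoid" "\<psi> \<in> groupoid" "composable \<phi> \<psi>"
      by (rule factorizationsE[OF p h(4) S(2)])
    \<comment> \<open>Additivity of \<phi> is available on its domain, and composability with \<psi>
      places both right coefficients there.\<close>
    have "f \<psi> \<in> dom \<phi>" "g \<psi> \<in> dom \<phi>"
      using p f(1) g(1) by (simp_all add: composable_def)
    moreover from this have "act \<phi> (f \<psi>) \<in> carrier \<Omega>" "act \<phi> (g \<psi>) \<in> carrier \<Omega>" "\<beta> \<phi> \<psi> \<in> carrier \<Omega>"
      using p act_hom(1) cocycle_closed(1) ran_closed(1) by blast+
    ultimately show "prod_term h (f \<oplus>\<^bsub>A\<^esub> g) p = prod_term h f p \<oplus> prod_term h g p"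
      using carrier_closed[OF assms(3)] p(2)
      by (simp add: p(1) prod_term_def A_add act_hom(3) r_distr l_distr)
  qed simp
  also have "\<dots> = finsum \<Omega> (prod_term h f) (factorizations \<chi> ?T ?S) \<oplus>
      finsum \<Omega> (prod_term h g) (factorizations \<chi> ?T ?S)"
    by (intro finsum_addf Pi assms)
  also have "\<dots> = (h \<otimes>\<^bsub>A\<^esub> f) \<chi> \<oplus> (h \<otimes>\<^bsub>A\<^esub> g) \<chi>"
    by (simp only: mult_superset[OF assms(3,1) h(3) subset_refl h(4) S(1,3,2)]
        mult_superset[OF assms(3,2) h(3) subset_refl h(4) S(1,4,2)])
  finally show "(h \<otimes>\<^bsub>A\<^esub> (f \<oplus>\<^bsub>A\<^esub> g)) \<chi> = (h \<otimes>\<^bsub>A\<^esub> f \<oplus>\<^bsub>A\<^esub> h \<otimes>\<^bsub>A\<^esub> g) \<chi>"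
    by (simp add: A_add)
qed

text \<open>Scalars from \<open>K\<close> lie in every object and are fixed by every groupoid
  element, so they can be pulled out of either factor.\<close>

lemma A_smult_mult:
  assumes "k \<in> K" "f \<in> carrier A" "h \<in> carrier A"
  shows "(k \<odot>\<^bsub>A\<^esub> f) \<otimes>\<^bsub>A\<^esub> h = k \<odot>\<^bsub>A\<^esub> (f \<otimes>\<^bsub>A\<^esub> h)"
    and "f \<otimes>\<^bsub>A\<^esub> (k \<odot>\<^bsub>A\<^esub> h) = k \<odot>\<^bsub>A\<^esub> (f \<otimes>\<^bsub>A\<^esub> h)"
proof -
  note f = carrierD[OF assms(2)] and h = carrierD[OF assms(3)]
  have k: "k \<in> carrier \<Omega>" using assms(1) subfieldE(3)[OF subfield_K] by auto
  let ?X = "\<lambda>\<chi>. factorizations \<chi> (support \<Omega> f) (support \<Omega> h)"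
  note Pi = prod_term_Pi[OF assms(2,3) f(4) h(4)]
  have supp: "support \<Omega> (k \<odot>\<^bsub>A\<^esub> f) \<subseteq> support \<Omega> f" "support \<Omega> (k \<odot>\<^bsub>A\<^esub> h) \<subseteq> support \<Omega> h"
    using k by (auto simp: support_def A_smult)
  have term_eq: "prod_term (k \<odot>\<^bsub>A\<^esub> f) h p = k \<otimes> prod_term f h p \<and>
      prod_term f (k \<odot>\<^bsub>A\<^esub> h) p = k \<otimes> prod_term f h p" if in_X: "p \<in> ?X \<chi>" for p \<chi>
  proof -
    obtain \<phi> \<psi> where p: "p = (\<phi>, \<psi>)" "\<phi> \<in> groupoid" "\<psi> \<in> groupoid" "composable \<phi> \<psi>"
      by (rule factorizationsE[OF in_X f(4) h(4)])
    have "h \<psi> \<in> dom \<phi>" "k \<in> dom \<phi>"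
      using p h(1) ran_closed(7) assms(1) by (simp_all add: composable_def)
    moreover from this have "act \<phi> (h \<psi>) \<in> carrier \<Omega>" "\<beta> \<phi> \<psi> \<in> carrier \<Omega>"
      using p act_hom(1) cocycle_closed(1) ran_closed(1) by blast+
    ultimately show ?thesis
      using carrier_closed[OF assms(2)] p(2) k assms(1)
      by (simp add: p(1) prod_term_def A_smult act_hom(2,4) m_assoc m_lcomm)
  qed
  have distr: "finsum \<Omega> (\<lambda>p. k \<otimes> prod_term f h p) (?X \<chi>) = (k \<odot>\<^bsub>A\<^esub> (f \<otimes>\<^bsub>A\<^esub> h)) \<chi>" for \<chi>
    using finsum_rdistr[OF finite_factorizations[OF f(3) h(3)] k Pi] by (simp add: A_smult A_mult)
  have Pi': "(\<lambda>p. k \<otimes> prod_term f h p) \<in> ?X \<chi> \<rightarrow> carrier \<Omega>" for \<chi>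
    using Pi[of \<chi>] k by auto
  show "(k \<odot>\<^bsub>A\<^esub> f) \<otimes>\<^bsub>A\<^esub> h = k \<odot>\<^bsub>A\<^esub> (f \<otimes>\<^bsub>A\<^esub> h)"
  proof
    fix \<chi>
    have "((k \<odot>\<^bsub>A\<^esub> f) \<otimes>\<^bsub>A\<^esub> h) \<chi> = finsum \<Omega> (prod_term (k \<odot>\<^bsub>A\<^esub> f) h) (?X \<chi>)"
      by (rule mult_superset[OF A_smult_closed[OF assms(1,2)] assms(3) f(3) supp(1) f(4) h(3) subset_refl h(4)])
    also have "\<dots> = finsum \<Omega> (\<lambda>p. k \<otimes> prod_term f h p) (?X \<chi>)"
      using term_eq by (intro finsum_cong' Pi') auto
    finally show "((k \<odot>\<^bsub>A\<^esub> f) \<otimes>\<^bsub>A\<^esub> h) \<chi> = (k \<odot>\<^bsub>A\<^esub> (f \<otimes>\<^bsub>A\<^esub> h)) \<chi>"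
      unfolding distr .
  qed
  show "f \<otimes>\<^bsub>A\<^esub> (k \<odot>\<^bsub>A\<^esub> h) = k \<odot>\<^bsub>A\<^esub> (f \<otimes>\<^bsub>A\<^esub> h)"
  proof
    fix \<chi>
    have "(f \<otimes>\<^bsub>A\<^esub> (k \<odot>\<^bsub>A\<^esub> h)) \<chi> = finsum \<Omega> (prod_term f (k \<odot>\<^bsub>A\<^esub> h)) (?X \<chi>)"
      by (rule mult_superset[OF assms(2) A_smult_closed[OF assms(1,3)] f(3) subset_refl f(4) h(3) supp(2) h(4)])
    also have "\<dots> = finsum \<Omega> (\<lambda>p. k \<otimes> prod_term f h p) (?X \<chi>)"
      using term_eq by (intro finsum_cong' Pi') auto
    finally show "(f \<otimes>\<^bsub>A\<^esub> (k \<odot>\<^bsub>A\<^esub> h)) \<chi> = (k \<odot>\<^bsub>A\<^esub> (f \<otimes>\<^bsub>A\<^esub> h)) \<chi>"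
      unfolding distr .
  qed
qed

section \<open>Monomials\<close>

lemma single_same [simp]: "single a \<phi> \<phi> = a"
  and single_other: "\<chi> \<noteq> \<phi> \<Longrightarrow> single a \<phi> \<chi> = \<zero>"
  by (simp_all add: single_def)

lemma support_single: "support \<Omega> (single a \<phi>) \<subseteq> {\<phi>}"
  by (auto simp: support_def single_def)

lemma single_closed: "\<phi> \<in> groupoid \<Longrightarrow> a \<in> ran \<phi> \<Longrightarrow> single a \<phi> \<in> carrier A"
  by (rule carrierI[OF _ support_single]) (auto simp: single_def ran_closed)

text \<open>With only one possible pair of factors the defining sum collapses to a single
  term.\<close>

lemma mult_unique_factorization:
  assumes "f \<in> carrier A" "h \<in> carrier A" "\<phi> \<in> groupoid" "\<psi> \<in> groupoid" "composable \<phi> \<psi>"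
    and "\<And>\<phi>' \<psi>'. \<phi>' \<in> support \<Omega> f \<Longrightarrow> \<psi>' \<in> support \<Omega> h \<Longrightarrow> composable \<phi>' \<psi>' \<Longrightarrow>
      \<phi>' \<circ>\<^sub>m \<psi>' = \<phi> \<circ>\<^sub>m \<psi> \<Longrightarrow> \<phi>' = \<phi> \<and> \<psi>' = \<psi>"
  shows "(f \<otimes>\<^bsub>A\<^esub> h) (\<phi> \<circ>\<^sub>m \<psi>) = f \<phi> \<otimes> act \<phi> (h \<psi>) \<otimes> \<beta> \<phi> \<psi>"
proof -
  let ?X = "factorizations (\<phi> \<circ>\<^sub>m \<psi>) (support \<Omega> f) (support \<Omega> h)"
  note f = carrierD[OF assms(1)] and h = carrierD[OF assms(2)]
  have closed: "prod_term f h (\<phi>, \<psi>) \<in> carrier \<Omega>"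
    using prod_term_closed[OF assms(1-5)] ran_closed(1)[OF assms(3)] by (simp add: prod_term_def)
  \<comment> \<open>Inclusion suffices: the pair is missing from \<open>?X\<close> when one of its
    coefficients vanishes, and then its term is zero as well.\<close>
  have sub: "?X \<subseteq> {(\<phi>, \<psi>)}"
    using assms(6) by (auto simp: factorizations_def)
  have "(f \<otimes>\<^bsub>A\<^esub> h) (\<phi> \<circ>\<^sub>m \<psi>) = finsum \<Omega> (prod_term f h) {(\<phi>, \<psi>)}"
    unfolding A_mult
  proof (rule add.finprod_mono_neutral_cong_left[OF _ sub])
    fix p assume "p \<in> {(\<phi>, \<psi>)} - ?X"
    then have p: "p = (\<phi>, \<psi>)" "f \<phi> = \<zero> \<or> h \<psi> = \<zero>"
      using assms(5) by (auto simp: factorizations_def support_def)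
    show "prod_term f h p = \<zero>"
      using prod_term_eq_zero[OF assms(1-5) p(2)] by (simp add: p(1) prod_term_def)
  qed (use closed in auto)
  also have "\<dots> = prod_term f h (\<phi>, \<psi>)"
    using finsum_insert[of "{}" "(\<phi>, \<psi>)" "prod_term f h"] closed by simp
  finally show ?thesis by (simp add: prod_term_def)
qed

text \<open>The right factor is forced by the support of the monomial, and
  \<open>comp_right_cancel\<close> then forces the left one.\<close>

lemma mult_single_right:
  assumes "f \<in> carrier A" "\<phi> \<in> groupoid" "\<psi> \<in> groupoid" "composable \<phi> \<psi>" "b \<in> ran \<psi>"
  shows "(f \<otimes>\<^bsub>A\<^esub> single b \<psi>) (\<phi> \<circ>\<^sub>m \<psi>) = f \<phi> \<otimes> act \<phi> b \<otimes> \<beta> \<phi> \<psi>"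
proof -
  have "\<phi>' = \<phi> \<and> \<psi>' = \<psi>" if "\<psi>' \<in> support \<Omega> (single b \<psi>)" "composable \<phi>' \<psi>'"
    "\<phi>' \<circ>\<^sub>m \<psi>' = \<phi> \<circ>\<^sub>m \<psi>" for \<phi>' \<psi>'
  proof -
    have "\<psi>' = \<psi>" using that(1) support_single by auto
    then show ?thesis using comp_right_cancel[OF assms(3)] that assms(4) by auto
  qed
  then show ?thesis
    using mult_unique_factorization[OF assms(1) single_closed[OF assms(3,5)] assms(2-4)] by simp
qed

text \<open>Right multiplication by a monomial translates the support by \<psi> and discards what is
  not composable. Hence a finite support cannot grow, as the minimality argument for ideals
  requires.\<close>

lemma support_mult_single:
  "support \<Omega> (f \<otimes>\<^bsub>A\<^esub> single b \<psi>) \<subseteq> (\<lambda>\<phi>. \<phi> \<circ>\<^sub>m \<psi>) ` {\<phi> \<in> support \<Omega> f. composable \<phi> \<psi>}"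
proof
  fix \<chi> assume "\<chi> \<in> support \<Omega> (f \<otimes>\<^bsub>A\<^esub> single b \<psi>)"
  then have "factorizations \<chi> (support \<Omega> f) (support \<Omega> (single b \<psi>)) \<noteq> {}"
    by (auto simp: support_def A_mult)
  then obtain \<phi> \<psi>' where *: "\<phi> \<in> support \<Omega> f" "\<psi>' \<in> support \<Omega> (single b \<psi>)"
    "composable \<phi> \<psi>'" "\<phi> \<circ>\<^sub>m \<psi>' = \<chi>"
    by (auto simp: factorizations_def)
  moreover have "\<psi>' = \<psi>" using *(2) support_single by auto
  ultimately show "\<chi> \<in> (\<lambda>\<phi>. \<phi> \<circ>\<^sub>m \<psi>) ` {\<phi> \<in> support \<Omega> f. composable \<phi> \<psi>}" by auto
qed

lemma single_mult:
  assumes "\<phi> \<in> groupoid" "\<psi> \<in> groupoid" "a \<in> ran \<phi>" "b \<in> ran \<psi>" "composable \<phi> \<psi>"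
  shows "single a \<phi> \<otimes>\<^bsub>A\<^esub> single b \<psi> = single (a \<otimes> act \<phi> b \<otimes> \<beta> \<phi> \<psi>) (\<phi> \<circ>\<^sub>m \<psi>)"
proof
  fix \<chi>
  show "(single a \<phi> \<otimes>\<^bsub>A\<^esub> single b \<psi>) \<chi> = single (a \<otimes> act \<phi> b \<otimes> \<beta> \<phi> \<psi>) (\<phi> \<circ>\<^sub>m \<psi>) \<chi>"
  proof (cases "\<chi> = \<phi> \<circ>\<^sub>m \<psi>")
    case True
    then show ?thesis
      using mult_single_right[OF single_closed[OF assms(1,3)] assms(1,2,5,4)] by simp
  next
    case False
    have "\<chi> \<notin> support \<Omega> (single a \<phi> \<otimes>\<^bsub>A\<^esub> single b \<psi>)"
      using False support_mult_single[of "single a \<phi>" b \<psi>] support_single[of a \<phi>] by auto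
    with False show ?thesis by (simp add: support_def single_other)
  qed
qed

lemma single_mult_zero:
  assumes "\<not> composable \<phi> \<psi>"
  shows "single a \<phi> \<otimes>\<^bsub>A\<^esub> single b \<psi> = \<zero>\<^bsub>A\<^esub>"
proof -
  have "support \<Omega> (single a \<phi> \<otimes>\<^bsub>A\<^esub> single b \<psi>) = {}"
    using assms support_mult_single[of "single a \<phi>" b \<psi>] support_single[of a \<phi>] by auto
  then show ?thesis by (auto simp: support_def A_zero)
qed

lemma A_mult_zero: "f \<otimes>\<^bsub>A\<^esub> \<zero>\<^bsub>A\<^esub> = \<zero>\<^bsub>A\<^esub>" "\<zero>\<^bsub>A\<^esub> \<otimes>\<^bsub>A\<^esub> f = \<zero>\<^bsub>A\<^esub>"
  by (auto simp: fun_eq_iff A_mult A_zero support_def factorizations_def)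

text \<open>Every element is a finite sum of monomials: deleting one term lowers the size of the
  support. Additive statements thereby reduce to monomials.\<close>

lemma A_induct [consumes 1, case_names zero single add]:
  assumes "f \<in> carrier A"
    and "P \<zero>\<^bsub>A\<^esub>"
    and "\<And>a \<phi>. \<phi> \<in> groupoid \<Longrightarrow> a \<in> ran \<phi> \<Longrightarrow> P (single a \<phi>)"
    and "\<And>f g. f \<in> carrier A \<Longrightarrow> g \<in> carrier A \<Longrightarrow> P f \<Longrightarrow> P g \<Longrightarrow> P (f \<oplus>\<^bsub>A\<^esub> g)"
  shows "P f"
  using assms(1)
proof (induction "card (support \<Omega> f)" arbitrary: f rule: less_induct)
  case less
  note f = carrierD[OF less.prems]
  show ?case
  proof (cases "support \<Omega> f = {}")
    case True
    then have "f = \<zero>\<^bsub>A\<^esub>" by (auto simp: support_def A_zero)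
    then show ?thesis using assms(2) by simp
  next
    case False
    then obtain \<phi> where \<phi>: "\<phi> \<in> support \<Omega> f" by auto
    define g where "g = f(\<phi> := \<zero>)"
    have supp: "support \<Omega> g = support \<Omega> f - {\<phi>}" by (auto simp: g_def support_def)
    have \<phi>_gr: "\<phi> \<in> groupoid" using \<phi> f(4) by auto
    have g: "g \<in> carrier A"
    proof (rule carrierI[OF _ _ f(3,4)])
      show "support \<Omega> g \<subseteq> support \<Omega> f" using supp by auto
      fix \<psi> assume "\<psi> \<in> groupoid"
      then show "g \<psi> \<in> ran \<psi>" using f(1) ran_closed(2) \<phi>_gr by (simp add: g_def)
    qed
    have "card (support \<Omega> g) < card (support \<Omega> f)"
      unfolding supp using \<phi> f(3) by (rule card_Diff1_less[rotated])
    then have "P g" using less.hyps g by blast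
    moreover have "f = single (f \<phi>) \<phi> \<oplus>\<^bsub>A\<^esub> g"
      using carrier_closed[OF less.prems] by (auto simp: A_add single_def g_def)
    ultimately show ?thesis
      using assms(3,4) single_closed \<phi>_gr f(1)[OF \<phi>_gr] g by metis
  qed
qed

text \<open>For composable factors this is the cocycle identity; in the other cases both sides
  vanish.\<close>

lemma single_assoc:
  assumes "\<phi> \<in> groupoid" "\<psi> \<in> groupoid" "\<chi> \<in> groupoid"
    and "a \<in> ran \<phi>" "b \<in> ran \<psi>" "c \<in> ran \<chi>"
  shows "(single a \<phi> \<otimes>\<^bsub>A\<^esub> single b \<psi>) \<otimes>\<^bsub>A\<^esub> single c \<chi> =
    single a \<phi> \<otimes>\<^bsub>A\<^esub> (single b \<psi> \<otimes>\<^bsub>A\<^esub> single c \<chi>)"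
proof (cases "composable \<phi> \<psi>")
  case False
  show ?thesis
  proof (cases "composable \<psi> \<chi>")
    case True
    \<comment> \<open>The composite has the same range as \<psi>, so \<phi> fails to compose with it
      for the same reason.\<close>
    then have "\<not> composable \<phi> (\<psi> \<circ>\<^sub>m \<chi>)" using False comp_ran[OF True] by (simp add: composable_def)
    then show ?thesis
      using False assms True by (simp add: single_mult single_mult_zero A_mult_zero)
  qed (use False in \<open>simp add: single_mult_zero A_mult_zero\<close>)
next
  case c1: True
  have gr1: "\<phi> \<circ>\<^sub>m \<psi> \<in> groupoid" using c1 assms comp_groupoid by blast
  have m1: "a \<otimes> act \<phi> b \<otimes> \<beta> \<phi> \<psi> \<in> ran (\<phi> \<circ>\<^sub>m \<psi>)"
    unfolding comp_ran[OF c1]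
    using c1 assms by (simp add: ran_closed act_composable cocycle_closed)
  show ?thesis
  proof (cases "composable \<psi> \<chi>")
    case False
    then have "\<not> composable (\<phi> \<circ>\<^sub>m \<psi>) \<chi>" using comp_dom[OF c1] by (simp add: composable_def)
    then show ?thesis
      using False assms c1 by (simp add: single_mult single_mult_zero A_mult_zero)
  next
    case c2: True
    have gr2: "\<psi> \<circ>\<^sub>m \<chi> \<in> groupoid" using c2 assms comp_groupoid by blast
    have m2: "b \<otimes> act \<psi> c \<otimes> \<beta> \<psi> \<chi> \<in> ran (\<psi> \<circ>\<^sub>m \<chi>)"
      unfolding comp_ran[OF c2]
      using c2 assms by (simp add: ran_closed act_composable cocycle_closed)
    have c3: "composable (\<phi> \<circ>\<^sub>m \<psi>) \<chi>" "composable \<phi> (\<psi> \<circ>\<^sub>m \<chi>)"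
      using c1 c2 comp_dom[OF c1] comp_ran[OF c2] by (simp_all add: composable_def)
    have mem: "b \<in> dom \<phi>" "act \<psi> c \<in> dom \<phi>" "\<beta> \<psi> \<chi> \<in> dom \<phi>" "c \<in> dom \<psi>"
      using c1 c2 assms act_composable cocycle_closed(1) by (auto simp: composable_def)
    note dcl = object_closed[OF dom_object[OF assms(1)]]
    have cl: "a \<in> carrier \<Omega>" "act \<phi> b \<in> carrier \<Omega>" "act \<phi> (act \<psi> c) \<in> carrier \<Omega>"
      "act \<phi> (\<beta> \<psi> \<chi>) \<in> carrier \<Omega>" "\<beta> \<phi> \<psi> \<in> carrier \<Omega>" "\<beta> (\<phi> \<circ>\<^sub>m \<psi>) \<chi> \<in> carrier \<Omega>"
      "\<beta> \<phi> (\<psi> \<circ>\<^sub>m \<chi>) \<in> carrier \<Omega>"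
      using ran_closed(1)[OF assms(1)] act_hom(1)[OF assms(1)] mem assms(4)
        cocycle_closed(1)[OF assms(1,2) c1] cocycle_closed(1)[OF assms(1) gr2 c3(2)]
        cocycle_closed(1)[OF gr1 assms(3) c3(1)] comp_ran[OF c1]
      by auto
    \<comment> \<open>The action of the composite is split first, then the cocycle identity is
      applied, and finally multiplicativity of \<phi> collects its arguments.\<close>
    have "a \<otimes> act \<phi> b \<otimes> \<beta> \<phi> \<psi> \<otimes> act (\<phi> \<circ>\<^sub>m \<psi>) c \<otimes> \<beta> (\<phi> \<circ>\<^sub>m \<psi>) \<chi> =
      a \<otimes> act \<phi> b \<otimes> act \<phi> (act \<psi> c) \<otimes> (\<beta> \<phi> \<psi> \<otimes> \<beta> (\<phi> \<circ>\<^sub>m \<psi>) \<chi>)"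
      unfolding act_comp[OF mem(4)] using cl by (simp add: m_ac)
    also have "\<dots> = a \<otimes> (act \<phi> b \<otimes> act \<phi> (act \<psi> c) \<otimes> act \<phi> (\<beta> \<psi> \<chi>)) \<otimes> \<beta> \<phi> (\<psi> \<circ>\<^sub>m \<chi>)"
      unfolding cocycle_eq[OF assms(1-3) c1 c2] using cl by (simp add: m_ac)
    also have "\<dots> = a \<otimes> act \<phi> (b \<otimes> act \<psi> c \<otimes> \<beta> \<psi> \<chi>) \<otimes> \<beta> \<phi> (\<psi> \<circ>\<^sub>m \<chi>)"
      using act_hom(2)[OF assms(1)] mem dcl(5) by simp
    finally show ?thesis
      using assms c1 c2 c3 gr1 gr2 m1 m2 by (simp add: single_mult comp_assoc)
  qed
qed

text \<open>Both sides are additive in each argument, so three nested inductions reduce the claim to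
  \<open>single_assoc\<close>.\<close>

lemma A_assoc:
  assumes "f \<in> carrier A" "g \<in> carrier A" "h \<in> carrier A"
  shows "(f \<otimes>\<^bsub>A\<^esub> g) \<otimes>\<^bsub>A\<^esub> h = f \<otimes>\<^bsub>A\<^esub> (g \<otimes>\<^bsub>A\<^esub> h)"
  using assms(1)
proof (induction f rule: A_induct)
  case (single a \<phi>)
  show ?case using assms(2)
  proof (induction g rule: A_induct)
    case (single b \<psi>)
    show ?case using assms(3)
    proof (induction h rule: A_induct)
      case (single c \<chi>)
      then show ?case
        using single_assoc \<open>\<phi> \<in> groupoid\<close> \<open>a \<in> ran \<phi>\<close> \<open>\<psi> \<in> groupoid\<close> \<open>b \<in> ran \<psi>\<close> by blast
    next
      case (add h h')
      then show ?case
        using single_closed[OF \<open>\<phi> \<in> groupoid\<close> \<open>a \<in> ran \<phi>\<close>] single_closed[OF \<open>\<psi> \<in> groupoid\<close> \<open>b \<in> ran \<psi>\<close>]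
        by (simp add: A_r_distr A_mult_closed)
    qed (simp add: A_mult_zero)
  next
    case (add g g')
    then show ?case
      using single_closed[OF \<open>\<phi> \<in> groupoid\<close> \<open>a \<in> ran \<phi>\<close>] assms(3)
      by (simp add: A_r_distr A_l_distr A_mult_closed)
  qed (simp add: A_mult_zero)
next
  case (add f f')
  then show ?case using assms(2,3) by (simp add: A_l_distr A_mult_closed)
qed (simp add: A_mult_zero)

lemma A_assoc_algebra: "assoc_algebra (\<Omega>\<lparr>carrier := K\<rparr>) A"
proof -
  have K: "k \<in> carrier \<Omega>" if "k \<in> K" for k using that subfieldE(3)[OF subfield_K] by auto
  have "cring (\<Omega>\<lparr>carrier := K\<rparr>)"
    using subfield_iff(2)[OF subfield_K] by (simp add: domain.axioms(1) field.axioms(1))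
  then have "module (\<Omega>\<lparr>carrier := K\<rparr>) A"
    using K carrier_closed
    by (intro moduleI A_abelian_group)
      (auto simp: A_smult_closed, auto simp: A_smult A_add fun_eq_iff l_distr r_distr m_assoc)
  then show ?thesis
    by (intro assoc_algebra.intro assoc_algebra_axioms.intro)
      (auto simp: A_mult_closed A_assoc A_l_distr A_r_distr A_smult_mult)
qed

subsection \<open>Ideals\<close>

text \<open>Monomials at identities, the unit when it exists, and all central elements have this
  form, so one product formula serves for all of them.\<close>

definition diagonal :: "(('a \<rightharpoonup> 'a) \<Rightarrow> 'a) \<Rightarrow> bool" where
  "diagonal z \<longleftrightarrow> z \<in> carrier A \<and> support \<Omega> z \<subseteq> id_map ` objects"

lemma id_map_composable:
  "composable (id_map S) \<phi> \<longleftrightarrow> ran \<phi> = S" "composable \<phi> (id_map S) \<longleftrightarrow> dom \<phi> = S"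
  by (auto simp: composable_def)

text \<open>With a diagonal left factor, \<chi> factors only through the identity of its range; with
  a diagonal right factor, only through that of its domain. Normalization of \<beta> removes the
  cocycle value.\<close>

lemma mult_diagonal:
  assumes "diagonal z" "f \<in> carrier A" "\<chi> \<in> groupoid"
  shows "(z \<otimes>\<^bsub>A\<^esub> f) \<chi> = z (id_map (ran \<chi>)) \<otimes> f \<chi>"
    and "(f \<otimes>\<^bsub>A\<^esub> z) \<chi> = f \<chi> \<otimes> act \<chi> (z (id_map (dom \<chi>)))"
proof -
  have z: "z \<in> carrier A" "support \<Omega> z \<subseteq> id_map ` objects"
    using assms(1) by (auto simp: diagonal_def)
  have ids: "id_map (ran \<chi>) \<in> groupoid" "id_map (dom \<chi>) \<in> groupoid"
    using assms(3) id_map_groupoid ran_object dom_object by auto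
  have "(z \<otimes>\<^bsub>A\<^esub> f) (id_map (ran \<chi>) \<circ>\<^sub>m \<chi>) =
      z (id_map (ran \<chi>)) \<otimes> act (id_map (ran \<chi>)) (f \<chi>) \<otimes> \<beta> (id_map (ran \<chi>)) \<chi>"
  proof (rule mult_unique_factorization[OF z(1) assms(2) ids(1) assms(3)])
    fix \<phi> \<psi> assume *: "\<phi> \<in> support \<Omega> z" "composable \<phi> \<psi>"
      "\<phi> \<circ>\<^sub>m \<psi> = id_map (ran \<chi>) \<circ>\<^sub>m \<chi>"
    from *(1) z(2) obtain S where "\<phi> = id_map S" by auto
    with * show "\<phi> = id_map (ran \<chi>) \<and> \<psi> = \<chi>"
      by (simp add: id_map_composable id_comp)
  qed (simp add: id_map_composable)
  moreover have "act (id_map (ran \<chi>)) (f \<chi>) = f \<chi>"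
    using carrierD(1)[OF assms(2,3)] by (rule act_id_map)
  ultimately show "(z \<otimes>\<^bsub>A\<^esub> f) \<chi> = z (id_map (ran \<chi>)) \<otimes> f \<chi>"
    using carrier_closed[OF z(1)] carrier_closed[OF assms(2)]
    by (simp add: id_comp cocycle_id(2)[OF assms(3)])
  have "(f \<otimes>\<^bsub>A\<^esub> z) (\<chi> \<circ>\<^sub>m id_map (dom \<chi>)) =
      f \<chi> \<otimes> act \<chi> (z (id_map (dom \<chi>))) \<otimes> \<beta> \<chi> (id_map (dom \<chi>))"
  proof (rule mult_unique_factorization[OF assms(2) z(1) assms(3) ids(2)])
    fix \<phi> \<psi> assume *: "\<psi> \<in> support \<Omega> z" "composable \<phi> \<psi>"
      "\<phi> \<circ>\<^sub>m \<psi> = \<chi> \<circ>\<^sub>m id_map (dom \<chi>)"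
    from *(1) z(2) obtain S where "\<psi> = id_map S" by auto
    with * show "\<phi> = \<chi> \<and> \<psi> = id_map (dom \<chi>)"
      by (simp add: id_map_composable comp_id)
  qed (simp add: id_map_composable)
  moreover have "act \<chi> (z (id_map (dom \<chi>))) \<in> carrier \<Omega>"
    using act_hom(1)[OF assms(3)] carrierD(1)[OF z(1) ids(2)] ran_closed(1)[OF assms(3)] by simp
  ultimately show "(f \<otimes>\<^bsub>A\<^esub> z) \<chi> = f \<chi> \<otimes> act \<chi> (z (id_map (dom \<chi>)))"
    using carrier_closed[OF assms(2)]
    by (simp add: comp_id cocycle_id(1)[OF assms(3)])
qed

lemma id_map_inject: "id_map S = id_map T \<longleftrightarrow> S = T"
  using id_map_dom by metis

lemma diagonal_single:
  assumes "S \<in> objects" "a \<in> S" shows "diagonal (single a (id_map S))"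
  unfolding diagonal_def
  using single_closed[OF id_map_groupoid[OF assms(1)], of a] assms support_single by auto

lemma mult_single_id:
  assumes "S \<in> objects" "a \<in> S" "f \<in> carrier A" "\<chi> \<in> groupoid"
  shows "(single a (id_map S) \<otimes>\<^bsub>A\<^esub> f) \<chi> = (if ran \<chi> = S then a \<otimes> f \<chi> else \<zero>)"
    and "(f \<otimes>\<^bsub>A\<^esub> single a (id_map S)) \<chi> = (if dom \<chi> = S then f \<chi> \<otimes> act \<chi> a else \<zero>)"
  using mult_diagonal[OF diagonal_single[OF assms(1,2)] assms(3,4)] carrier_closed[OF assms(3)]
    act_hom(5)[OF assms(4)]
  by (auto simp: single_def id_map_inject)

lemma carrier_eqI:
  assumes "f \<in> carrier A" "g \<in> carrier A" "\<And>\<chi>. \<chi> \<in> groupoid \<Longrightarrow> f \<chi> = g \<chi>"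
  shows "f = g"
  using assms carrierD(2) by (metis ext)

lemma act_minus:
  assumes "\<phi> \<in> groupoid" "a \<in> dom \<phi>" shows "act \<phi> (\<ominus> a) = \<ominus> act \<phi> a"
proof -
  note dcl = object_closed[OF dom_object[OF assms(1)]]
  have m: "\<ominus> a \<in> dom \<phi>" using dcl(4) assms(2) by blast
  have "act \<phi> (\<ominus> a) \<oplus> act \<phi> a = act \<phi> (\<ominus> a \<oplus> a)"
    using act_hom(3)[OF assms(1) m assms(2)] by simp
  also have "\<dots> = \<zero>" using dcl(1)[OF assms(2)] act_hom(5)[OF assms(1)] by (simp add: l_neg)
  finally show ?thesis
    using act_hom(1)[OF assms(1)] assms(2) m ran_closed(1)[OF assms(1)]
    by (intro minus_equality[symmetric]) auto
qed

text \<open>Once translated so that its coefficient at an identity \<open>e\<close> is nonzero, an element \<open>y\<close> of minimal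
  support commutes with every \<open>a u\<^sub>e\<close>: the commutator lies in the ideal and has smaller support.\<close>

lemma ideal_contains_single:
  assumes J: "two_sided_ideal J A" and nz: "J \<noteq> {\<zero>\<^bsub>A\<^esub>}"
  obtains c S where "S \<in> objects" "c \<in> S" "c \<noteq> \<zero>" "single c (id_map S) \<in> J"
proof -
  have sub: "subgroup J (add_monoid A)"
    using J by (auto simp: two_sided_ideal_def additive_subgroup_def)
  have JA: "\<And>x. x \<in> J \<Longrightarrow> x \<in> carrier A"
    using subgroup.subset[OF sub] by auto
  have J0: "\<zero>\<^bsub>A\<^esub> \<in> J" using subgroup.one_closed[OF sub] by simp
  have J_add: "\<And>x y. x \<in> J \<Longrightarrow> y \<in> J \<Longrightarrow> x \<oplus>\<^bsub>A\<^esub> y \<in> J"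
    using subgroup.m_closed[OF sub] by simp
  have J_mult: "\<And>x y. x \<in> carrier A \<Longrightarrow> y \<in> J \<Longrightarrow> x \<otimes>\<^bsub>A\<^esub> y \<in> J"
    "\<And>x y. x \<in> carrier A \<Longrightarrow> y \<in> J \<Longrightarrow> y \<otimes>\<^bsub>A\<^esub> x \<in> J"
    using J by (auto simp: two_sided_ideal_def)
  from nz J0 obtain x0 where "x0 \<in> J \<and> x0 \<noteq> \<zero>\<^bsub>A\<^esub>" by blast
  \<comment> \<open>A nonzero element of \<open>J\<close> with the fewest terms is selected.\<close>
  from ex_has_least_nat[of "\<lambda>x. x \<in> J \<and> x \<noteq> \<zero>\<^bsub>A\<^esub>", OF this, of "\<lambda>x. card (support \<Omega> x)"]
  obtain x where x: "x \<in> J" "x \<noteq> \<zero>\<^bsub>A\<^esub>"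
    and min: "\<And>y. y \<in> J \<Longrightarrow> y \<noteq> \<zero>\<^bsub>A\<^esub> \<Longrightarrow> card (support \<Omega> x) \<le> card (support \<Omega> y)"
    by blast
  note xc = carrierD[OF JA[OF x(1)]]
  obtain \<phi> where \<phi>: "x \<phi> \<noteq> \<zero>" using x(2) by (auto simp: A_zero)
  then have \<phi>_gr: "\<phi> \<in> groupoid" using xc(2) by blast
  \<comment> \<open>Right translation by an inverse of \<phi> will move the term at \<phi> to an
    identity.\<close>
  obtain \<psi> where \<psi>: "\<psi> \<in> groupoid" "dom \<psi> = ran \<phi>" "ran \<psi> = dom \<phi>" "\<phi> \<circ>\<^sub>m \<psi> = id_map (ran \<phi>)"
    using groupoid_inverse[OF \<phi>_gr] by metis
  have cmp: "composable \<phi> \<psi>" using \<psi> by (simp add: composable_def)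
  define S where "S = ran \<phi>"
  have S: "S \<in> objects" unfolding S_def using \<phi>_gr by (rule ran_object)
  note Scl = object_closed[OF S]
  have idS: "id_map S \<in> groupoid" using S by (rule id_map_groupoid)
  define y where "y = x \<otimes>\<^bsub>A\<^esub> single \<one> \<psi>"
  have y: "y \<in> J" unfolding y_def
    using J_mult(2) x(1) single_closed[OF \<psi>(1) ran_closed(3)[OF \<psi>(1)]] by blast
  note yA = JA[OF y]
  note yc = carrierD[OF yA]
  define c where "c = y (id_map S)"
  have c_mem: "c \<in> S" unfolding c_def using yc(1)[OF idS] by simp
  have "c = x \<phi> \<otimes> act \<phi> \<one> \<otimes> \<beta> \<phi> \<psi>"
    unfolding c_def y_def S_def \<psi>(4)[symmetric]
    using mult_single_right[OF JA[OF x(1)] \<phi>_gr \<psi>(1) cmp ran_closed(3)[OF \<psi>(1)]] .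
  \<comment> \<open>\<Omega> is a domain, and \<open>c\<close> is a product of a nonzero
    coefficient, the image of one and a nonzero cocycle value.\<close>
  then have c_nz: "c \<noteq> \<zero>"
    using \<phi> cocycle_closed[OF \<phi>_gr \<psi>(1) cmp] ran_closed(1)[OF \<phi>_gr] xc(1)[OF \<phi>_gr]
      act_hom(6)[OF \<phi>_gr] by (simp add: integral_iff)
  \<comment> \<open>Translation does not enlarge the support. So an element of \<open>J\<close>
    supported strictly inside the support of \<open>y\<close> would beat the minimum unless it is
    zero.\<close>
  have "card (support \<Omega> y) \<le> card {\<phi> \<in> support \<Omega> x. composable \<phi> \<psi>}"
    unfolding y_def by (rule surj_card_le[OF _ support_mult_single]) (use xc(3) in simp)
  also have "\<dots> \<le> card (support \<Omega> x)" by (rule card_mono[OF xc(3)]) auto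
  finally have smaller: "w = \<zero>\<^bsub>A\<^esub>" if "w \<in> J" "support \<Omega> w \<subset> support \<Omega> y" for w
    using min[OF that(1)] psubset_card_mono[OF yc(3) that(2)] by linarith
  have commute: "(if ran \<chi> = S then a \<otimes> y \<chi> else \<zero>) =
      (if dom \<chi> = S then y \<chi> \<otimes> act \<chi> a else \<zero>)" if a: "a \<in> S" and \<chi>: "\<chi> \<in> groupoid" for a \<chi>
  proof -
    \<comment> \<open>The commutator of \<open>y\<close> with the monomial of coefficient
      \<open>a\<close> at \<open>id_map S\<close>; the subtraction is expressed by
      \<open>\<ominus> a\<close>.\<close>
    define w where "w = single a (id_map S) \<otimes>\<^bsub>A\<^esub> y \<oplus>\<^bsub>A\<^esub> y \<otimes>\<^bsub>A\<^esub> single (\<ominus> a) (id_map S)"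
    have sc: "single a (id_map S) \<in> carrier A" "single (\<ominus> a) (id_map S) \<in> carrier A"
      using single_closed[OF idS] a Scl(4) by simp_all
    have w: "w \<in> J" unfolding w_def using J_add J_mult y sc by blast
    have w_eq: "w \<chi> = (if ran \<chi> = S then a \<otimes> y \<chi> else \<zero>) \<oplus>
        (if dom \<chi> = S then y \<chi> \<otimes> act \<chi> (\<ominus> a) else \<zero>)" if "\<chi> \<in> groupoid" for \<chi>
      unfolding w_def A_add
      using mult_single_id[OF S _ yA that] a Scl(4) by simp
    have act_cl: "act \<chi> a \<in> carrier \<Omega>" "act \<chi> (\<ominus> a) = \<ominus> act \<chi> a"
      if "\<chi> \<in> groupoid" "dom \<chi> = S" for \<chi>
      using that a act_minus act_hom(1) ran_closed(1) by auto
    have "support \<Omega> w \<subseteq> support \<Omega> y"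
    proof
      fix \<chi> assume \<chi>: "\<chi> \<in> support \<Omega> w"
      then have gr: "\<chi> \<in> groupoid" using carrierD(4)[OF JA[OF w]] by auto
      show "\<chi> \<in> support \<Omega> y"
        using \<chi> w_eq[OF gr] act_cl[OF gr] Scl(1)[OF a] by (auto simp: support_def split: if_splits)
    qed
    \<comment> \<open>At the identity the two contributions cancel because \<Omega> is commutative.
      As \<open>y\<close> has the nonzero coefficient \<open>c\<close> there, the support becomes
      strictly smaller.\<close>
    moreover have "w (id_map S) = \<zero>"
      using w_eq[OF idS] act_id_map[of _ S] a Scl(4)[OF a] Scl(1)[OF a] Scl(1)[OF c_mem]
      by (simp add: c_def[symmetric] r_minus m_comm r_neg)
    ultimately have "support \<Omega> w \<subset> support \<Omega> y"
      using c_nz by (auto simp: support_def c_def)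
    then have "w \<chi> = \<zero>" using smaller[OF w] by (simp add: A_zero)
    then show ?thesis
      using w_eq[OF \<chi>] act_cl[OF \<chi>] Scl(1)[OF a] carrier_closed[OF yA]
      by (auto simp: r_minus minus_eq[symmetric] r_right_minus_eq split: if_splits)
  qed
  \<comment> \<open>The left factor cuts out the terms of \<open>y\<close> with range
    \<open>S\<close>, and \<open>commute\<close> excludes all of them except the one at the
    identity.\<close>
  have "single \<one> (id_map S) \<otimes>\<^bsub>A\<^esub> y = single c (id_map S)"
  proof (rule carrier_eqI)
    show "single \<one> (id_map S) \<otimes>\<^bsub>A\<^esub> y \<in> carrier A"
      using A_mult_closed single_closed[OF idS] Scl(3) yA by simp
    show "single c (id_map S) \<in> carrier A" using single_closed[OF idS] c_mem by simp
    fix \<chi> assume \<chi>: "\<chi> \<in> groupoid"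
    have eq: "(single \<one> (id_map S) \<otimes>\<^bsub>A\<^esub> y) \<chi> = (if ran \<chi> = S then y \<chi> else \<zero>)"
      using mult_single_id(1)[OF S Scl(3) yA \<chi>] carrier_closed[OF yA] by simp
    show "(single \<one> (id_map S) \<otimes>\<^bsub>A\<^esub> y) \<chi> = single c (id_map S) \<chi>"
    proof (cases "\<chi> = id_map S")
      case True
      then show ?thesis using eq by (simp add: c_def)
    next
      case False
      have "y \<chi> = \<zero>" if r: "ran \<chi> = S"
      proof (rule ccontr)
        assume nz: "y \<chi> \<noteq> \<zero>"
        \<comment> \<open>The case \<open>a = \<one>\<close> of \<open>commute\<close> would make
          \<open>y \<chi>\<close> zero if the domain differed from the range.\<close>
        have d: "dom \<chi> = S"
          using commute[OF Scl(3) \<chi>] r nz carrier_closed[OF yA] by (auto split: if_splits)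
        have "act \<chi> a = a" if a: "a \<in> S" for a
        proof -
          have cl: "act \<chi> a \<in> carrier \<Omega>" "a \<in> carrier \<Omega>" "y \<chi> \<in> carrier \<Omega>"
            using act_hom(1)[OF \<chi>] ran_closed(1)[OF \<chi>] d a Scl(1) carrier_closed[OF yA] by auto
          have "y \<chi> \<otimes> act \<chi> a = y \<chi> \<otimes> a"
            using commute[OF a \<chi>] r d cl by (simp add: m_comm)
          then show ?thesis using m_lcancel[OF nz cl(3,1,2)] by simp
        qed
        then have "\<chi> = id_map S" using id_mapI[of \<chi>] d by simp
        with False show False by simp
      qed
      then show ?thesis using eq False by (simp add: single_other)
    qed
  qed
  moreover have "single \<one> (id_map S) \<otimes>\<^bsub>A\<^esub> y \<in> J"
    using J_mult(1) single_closed[OF idS] Scl(3) y by simp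
  ultimately show thesis using that S c_mem c_nz by metis
qed

text \<open>A nonzero ideal contains a monomial at some identity. By connectedness, multiplication
  from both sides moves it to any \<chi> with a nonzero coefficient; that coefficient is invertible,
  so all monomials, and hence all their sums, lie in the ideal.\<close>

lemma A_ideals:
  assumes J: "two_sided_ideal J A"
  shows "J = {\<zero>\<^bsub>A\<^esub>} \<or> J = carrier A"
proof (cases "J = {\<zero>\<^bsub>A\<^esub>}")
  case False
  have sub: "subgroup J (add_monoid A)"
    using J by (auto simp: two_sided_ideal_def additive_subgroup_def)
  have J_mult: "\<And>x y. x \<in> carrier A \<Longrightarrow> y \<in> J \<Longrightarrow> x \<otimes>\<^bsub>A\<^esub> y \<in> J"
    "\<And>x y. x \<in> carrier A \<Longrightarrow> y \<in> J \<Longrightarrow> y \<otimes>\<^bsub>A\<^esub> x \<in> J"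
    using J by (auto simp: two_sided_ideal_def)
  obtain c S where c: "S \<in> objects" "c \<in> S" "c \<noteq> \<zero>" "single c (id_map S) \<in> J"
    using ideal_contains_single[OF J False] .
  have singles: "single a \<chi> \<in> J" if \<chi>: "\<chi> \<in> groupoid" and a: "a \<in> ran \<chi>" for a \<chi>
  proof -
    obtain \<phi> where \<phi>: "\<phi> \<in> groupoid" "dom \<phi> = S" "ran \<phi> = ran \<chi>"
      using groupoid_connected[OF c(1) ran_object[OF \<chi>]] by blast
    obtain \<phi>' where \<phi>': "\<phi>' \<in> groupoid" "dom \<phi>' = ran \<phi>" "ran \<phi>' = dom \<phi>"
      "\<phi> \<circ>\<^sub>m \<phi>' = id_map (ran \<phi>)"
      using groupoid_inverse[OF \<phi>(1)] by metis
    have c1: "composable \<phi>' \<chi>" using \<phi> \<phi>' by (simp add: composable_def)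
    \<comment> \<open>The right factor is chosen so that composing \<phi> with it gives back \<chi>,
      passing through \<open>S\<close>, where the known monomial sits.\<close>
    define \<psi> where "\<psi> = \<phi>' \<circ>\<^sub>m \<chi>"
    have \<psi>: "\<psi> \<in> groupoid" "ran \<psi> = S"
      unfolding \<psi>_def using comp_groupoid[OF \<phi>'(1) \<chi> c1] comp_ran[OF c1] \<phi> \<phi>' by auto
    have c2: "composable \<phi> \<psi>" using \<phi> \<psi> by (simp add: composable_def)
    have comp: "\<phi> \<circ>\<^sub>m \<psi> = \<chi>"
      unfolding \<psi>_def comp_assoc[symmetric] \<phi>'(4) using \<phi>(3) by (simp add: id_comp)
    have idS: "id_map S \<in> groupoid" "id_map (ran \<chi>) \<in> groupoid"
      using id_map_groupoid c(1) ran_object[OF \<chi>] by auto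
    note rcl = ran_closed[OF \<chi>]
    define d where "d = act \<phi> c"
    \<comment> \<open>Injectivity of the action keeps the transported coefficient nonzero.\<close>
    have d: "d \<in> ran \<chi>" "d \<noteq> \<zero>"
      unfolding d_def
      using act_hom(1)[OF \<phi>(1)] act_hom(7)[OF \<phi>(1), of c \<zero>] act_hom(5)[OF \<phi>(1)] c(2,3) \<phi>(2,3)
        object_closed(2)[OF c(1)] by auto
    have "single \<one> \<phi> \<otimes>\<^bsub>A\<^esub> single c (id_map S) = single d \<phi>"
      using single_mult[OF \<phi>(1) idS(1) ran_closed(3)[OF \<phi>(1)], of c] c(2) \<phi>(2) rcl(1)[OF d(1)]
      by (simp add: id_map_composable comp_id cocycle_id(1)[OF \<phi>(1)] d_def)
    then have "single d \<phi> \<in> J"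
      using J_mult(1)[OF single_closed[OF \<phi>(1) ran_closed(3)[OF \<phi>(1)]] c(4)] by simp
    moreover define e where "e = d \<otimes> \<beta> \<phi> \<psi>"
    have \<beta>: "\<beta> \<phi> \<psi> \<in> ran \<chi>" "\<beta> \<phi> \<psi> \<noteq> \<zero>"
      using cocycle_closed[OF \<phi>(1) \<psi>(1) c2] \<phi>(3) by auto
    have e: "e \<in> ran \<chi>" "e \<noteq> \<zero>"
      unfolding e_def using d \<beta> rcl(1,5) by (auto simp: integral_iff)
    have "single d \<phi> \<otimes>\<^bsub>A\<^esub> single \<one> \<psi> = single e \<chi>"
      using single_mult[OF \<phi>(1) \<psi>(1) _ ran_closed(3)[OF \<psi>(1)] c2, of d] d rcl(1) \<phi>(3)
      by (simp add: comp e_def act_hom(6)[OF \<phi>(1)])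
    ultimately have e_J: "single e \<chi> \<in> J"
      using J_mult(2)[OF single_closed[OF \<psi>(1) ran_closed(3)[OF \<psi>(1)]]] by metis
    have inv: "inv e \<in> ran \<chi>" "inv e \<otimes> e = \<one>"
      using rcl(8) e rcl(1)[OF e(1)] by (auto simp: field_Units)
    have ae: "a \<otimes> inv e \<in> ran (id_map (ran \<chi>))"
      using rcl(5) a inv(1) by simp
    \<comment> \<open>The left factor turns the coefficient \<open>e\<close> into the prescribed
      \<open>a\<close>; at an identity neither the action nor \<beta> interferes.\<close>
    have "single (a \<otimes> inv e) (id_map (ran \<chi>)) \<otimes>\<^bsub>A\<^esub> single e \<chi> = single (a \<otimes> inv e \<otimes> e \<otimes> \<one>) \<chi>"
      using single_mult[OF idS(2) \<chi> ae e(1)] e(1)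
      by (simp add: id_map_composable id_comp act_id_map cocycle_id(2)[OF \<chi>])
    also have "a \<otimes> inv e \<otimes> e \<otimes> \<one> = a"
      using rcl(1) a e(1) inv by (simp add: m_assoc)
    finally show ?thesis
      using J_mult(1)[OF single_closed[OF idS(2) ae] e_J] by simp
  qed
  have "f \<in> J" if "f \<in> carrier A" for f
    using that
  proof (induction f rule: A_induct)
    case zero
    then show ?case using subgroup.one_closed[OF sub] by simp
  next
    case (single a \<phi>)
    then show ?case by (rule singles)
  next
    case (add f g)
    then show ?case using subgroup.m_closed[OF sub] by simp
  qed
  moreover have "J \<subseteq> carrier A" using subgroup.subset[OF sub] by simp
  ultimately show ?thesis by blast
qed simp

lemma A_simple: "simple_algebra (\<Omega>\<lparr>carrier := K\<rparr>) A"
  unfolding simple_algebra_def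
proof (intro conjI allI impI)
  have gr: "id_map L \<in> groupoid" using id_map_groupoid[OF L_object] .
  let ?u = "single \<one> (id_map L)"
  have u: "?u \<in> carrier A" using single_closed[OF gr ran_closed(3)[OF gr]] .
  \<comment> \<open>The idempotent at \<open>L\<close> witnesses that the multiplication is not
    identically zero.\<close>
  have "(?u \<otimes>\<^bsub>A\<^esub> ?u) (id_map L) = \<one>"
    using mult_single_id(1)[OF L_object object_closed(3)[OF L_object] u gr] by simp
  then have "?u \<otimes>\<^bsub>A\<^esub> ?u \<noteq> \<zero>\<^bsub>A\<^esub>" by (auto simp: A_zero)
  then show "\<exists>x\<in>carrier A. \<exists>y\<in>carrier A. x \<otimes>\<^bsub>A\<^esub> y \<noteq> \<zero>\<^bsub>A\<^esub>" using u by blast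
qed (rule A_assoc_algebra, rule A_ideals)

subsection \<open>Unit and center\<close>

lemma A_one: "\<one>\<^bsub>A\<^esub> = (\<lambda>\<phi>. if \<phi> \<in> id_map ` objects then \<one> else \<zero>)"
  by (simp add: crossed_product_def)

text \<open>Finiteness of the set of conjugate fields is what makes the support finite and puts this
  element into the carrier.\<close>

lemma diagonal_one:
  assumes "finite objects" shows "diagonal \<one>\<^bsub>A\<^esub>"
  unfolding diagonal_def
proof
  show "support \<Omega> \<one>\<^bsub>A\<^esub> \<subseteq> id_map ` objects" by (auto simp: support_def A_one)
  then show "\<one>\<^bsub>A\<^esub> \<in> carrier A"
    by (rule carrierI[rotated]) (use assms id_map_groupoid ran_closed in \<open>auto simp: A_one\<close>)
qed

lemma A_one_mult:
  assumes "finite objects" "f \<in> carrier A"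
  shows "\<one>\<^bsub>A\<^esub> \<otimes>\<^bsub>A\<^esub> f = f" "f \<otimes>\<^bsub>A\<^esub> \<one>\<^bsub>A\<^esub> = f"
proof -
  have one: "\<one>\<^bsub>A\<^esub> \<in> carrier A" using diagonal_one[OF assms(1)] by (simp add: diagonal_def)
  have ones: "\<one>\<^bsub>A\<^esub> (id_map S) = \<one>" if "S \<in> objects" for S using that by (simp add: A_one)
  show "\<one>\<^bsub>A\<^esub> \<otimes>\<^bsub>A\<^esub> f = f"
    using mult_diagonal(1)[OF diagonal_one[OF assms(1)] assms(2)] A_mult_closed one assms(2)
      carrier_closed[OF assms(2)]
    by (intro carrier_eqI) (simp_all add: ones ran_object)
  show "f \<otimes>\<^bsub>A\<^esub> \<one>\<^bsub>A\<^esub> = f"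
    using mult_diagonal(2)[OF diagonal_one[OF assms(1)] assms(2)] A_mult_closed one assms(2)
      carrier_closed[OF assms(2)]
    by (intro carrier_eqI) (simp_all add: ones dom_object act_hom(6))
qed

text \<open>\<open>id_map\<close> is injective on objects. The lemma is applied to the support of a
  single element.\<close>

lemma finite_objects:
  assumes "finite J" "id_map ` objects \<subseteq> J" shows "finite objects"
  using finite_imageD[OF finite_subset[OF assms(2,1)]] by (auto simp: inj_on_def id_map_inject)

lemma unital_iff: "unital A \<longleftrightarrow> finite objects"
proof
  assume "finite objects"
  then show "unital A"
    unfolding unital_def using A_one_mult diagonal_one by (intro bexI[of _ "\<one>\<^bsub>A\<^esub>"]) (auto simp: diagonal_def)
next
  assume "unital A"
  then obtain e where e: "e \<in> carrier A" "\<And>x. x \<in> carrier A \<Longrightarrow> e \<otimes>\<^bsub>A\<^esub> x = x"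
    by (auto simp: unital_def)
  \<comment> \<open>Testing \<open>e\<close> on the monomial with coefficient one at
    \<open>id_map S\<close> forces coefficient one there, so a unit is supported on every
    identity.\<close>
  have "id_map S \<in> support \<Omega> e" if S: "S \<in> objects" for S
  proof -
    have gr: "id_map S \<in> groupoid" using S by (rule id_map_groupoid)
    have o: "\<one> \<in> S" using object_closed(3)[OF S] .
    have "e (id_map S) \<otimes> act (id_map S) \<one> = (e \<otimes>\<^bsub>A\<^esub> single \<one> (id_map S)) (id_map S)"
      using mult_single_id(2)[OF S o e(1) gr] by simp
    also have "\<dots> = \<one>" using e(2)[OF single_closed[OF gr]] o by simp
    finally have "e (id_map S) = \<one>"
      using carrier_closed[OF e(1)] act_hom(6)[OF gr] by simp
    then show ?thesis by (simp add: support_def)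
  qed
  then show "finite objects" using finite_objects carrierD(3)[OF e(1)] by blast
qed

text \<open>Commuting with monomials at identities forces a central element to be diagonal, and
  commuting with \<open>u\<^sub>\<psi>\<close> transports its coefficients along \<psi>. Conversely,
  these properties make the two formulas of \<open>mult_diagonal\<close> agree.\<close>

lemma center_iff:
  "z \<in> carrier (center A) \<longleftrightarrow>
    diagonal z \<and> (\<forall>\<psi>\<in>groupoid. z (id_map (ran \<psi>)) = act \<psi> (z (id_map (dom \<psi>))))"
    (is "_ \<longleftrightarrow> ?R")
proof
  assume "z \<in> carrier (center A)"
  then have z: "z \<in> carrier A" and comm: "\<And>x. x \<in> carrier A \<Longrightarrow> z \<otimes>\<^bsub>A\<^esub> x = x \<otimes>\<^bsub>A\<^esub> z"
    by (auto simp: center_def)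
  have diag: "diagonal z"
    unfolding diagonal_def
  proof (intro conjI z subsetI)
    fix \<phi> assume "\<phi> \<in> support \<Omega> z"
    then have nz: "z \<phi> \<noteq> \<zero>" and \<phi>: "\<phi> \<in> groupoid"
      using carrierD(4)[OF z] by (auto simp: support_def)
    define S where "S = dom \<phi>"
    have S: "S \<in> objects" unfolding S_def using \<phi> by (rule dom_object)
    \<comment> \<open>The two products with the monomial at \<open>id_map S\<close> are compared at
      \<phi>. Since \<open>S\<close> is the domain of \<phi>, the right product always contributes
      its term.\<close>
    have eq: "z \<phi> \<otimes> act \<phi> a = (if ran \<phi> = S then a \<otimes> z \<phi> else \<zero>)" if a: "a \<in> S" for a
    proof -
      have "single a (id_map S) \<in> carrier A"
        using single_closed[OF id_map_groupoid[OF S]] a by simp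
      from comm[OF this] show ?thesis
        using mult_single_id[OF S a z \<phi>] S_def by simp
    qed
    have zc: "z \<phi> \<in> carrier \<Omega>" using carrier_closed[OF z] .
    \<comment> \<open>For \<open>a = \<one>\<close> the left side is the nonzero
      \<open>z \<phi>\<close>, so the conditional cannot take its zero branch.\<close>
    have r: "ran \<phi> = S"
      using eq[OF object_closed(3)[OF S]] act_hom(6)[OF \<phi>] nz zc by (auto split: if_splits)
    have "act \<phi> a = a" if a: "a \<in> dom \<phi>" for a
    proof -
      have cl: "act \<phi> a \<in> carrier \<Omega>" "a \<in> carrier \<Omega>"
        using act_hom(1)[OF \<phi> a] ran_closed(1)[OF \<phi>] object_closed(1)[OF S] a S_def by auto
      have "z \<phi> \<otimes> act \<phi> a = z \<phi> \<otimes> a"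
        using eq[of a] a r S_def cl zc by (simp add: m_comm)
      then show ?thesis using m_lcancel[OF nz zc cl] by simp
    qed
    then have "\<phi> = id_map S" unfolding S_def by (rule id_mapI)
    then show "\<phi> \<in> id_map ` objects" using S by blast
  qed
  moreover have "z (id_map (ran \<psi>)) = act \<psi> (z (id_map (dom \<psi>)))" if \<psi>: "\<psi> \<in> groupoid" for \<psi>
  proof -
    have u: "single \<one> \<psi> \<in> carrier A" using single_closed[OF \<psi> ran_closed(3)[OF \<psi>]] .
    have "z (id_map (dom \<psi>)) \<in> dom \<psi>"
      using carrierD(1)[OF z id_map_groupoid[OF dom_object[OF \<psi>]]] by simp
    then have "act \<psi> (z (id_map (dom \<psi>))) \<in> carrier \<Omega>"
      using act_hom(1)[OF \<psi>] ran_closed(1)[OF \<psi>] by blast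
    then show ?thesis
      using mult_diagonal[OF diag u \<psi>] comm[OF u] carrier_closed[OF z] by simp
  qed
  ultimately show ?R by blast
next
  assume R: ?R
  then have diag: "diagonal z" and z: "z \<in> carrier A" by (auto simp: diagonal_def)
  have "z \<otimes>\<^bsub>A\<^esub> x = x \<otimes>\<^bsub>A\<^esub> z" if x: "x \<in> carrier A" for x
  proof (rule carrier_eqI)
    fix \<chi> assume \<chi>: "\<chi> \<in> groupoid"
    then have "z (id_map (ran \<chi>)) = act \<chi> (z (id_map (dom \<chi>)))" using R by blast
    then show "(z \<otimes>\<^bsub>A\<^esub> x) \<chi> = (x \<otimes>\<^bsub>A\<^esub> z) \<chi>"
      using mult_diagonal[OF diag x \<chi>] carrier_closed[OF z] carrier_closed[OF x] m_comm by metis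
  qed (use A_mult_closed z x in auto)
  with z show "z \<in> carrier (center A)" by (simp add: center_def)
qed

lemma centerD:
  assumes "z \<in> carrier (center A)"
  shows "diagonal z" "z \<in> carrier A"
    "\<psi> \<in> groupoid \<Longrightarrow> z (id_map (ran \<psi>)) = act \<psi> (z (id_map (dom \<psi>)))"
  using assms unfolding center_iff by (auto simp: diagonal_def)

lemma center_coeff_closed:
  "z \<in> carrier (center A) \<Longrightarrow> S \<in> objects \<Longrightarrow> z (id_map S) \<in> S"
  using carrierD(1)[OF centerD(2) id_map_groupoid] by simp

lemma center_zero: "\<zero>\<^bsub>A\<^esub> \<in> carrier (center A)"
  by (simp add: center_def A_zero_closed A_mult_zero)

text \<open>Transport along the connected groupoid spreads one nonzero coefficient to every
  identity, against finiteness of the support.\<close>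

lemma center_infinite:
  assumes "infinite objects" shows "carrier (center A) = {\<zero>\<^bsub>A\<^esub>}"
proof -
  have "z = \<zero>\<^bsub>A\<^esub>" if z: "z \<in> carrier (center A)" for z
  proof (rule ccontr)
    assume "z \<noteq> \<zero>\<^bsub>A\<^esub>"
    then obtain \<phi> where "\<phi> \<in> support \<Omega> z" by (auto simp: A_zero support_def)
    then obtain S where S: "S \<in> objects" "z (id_map S) \<noteq> \<zero>"
      using centerD(1)[OF z] by (auto simp: diagonal_def support_def)
    have "id_map T \<in> support \<Omega> z" if "T \<in> objects" for T
    proof -
      obtain \<psi> where \<psi>: "\<psi> \<in> groupoid" "dom \<psi> = S" "ran \<psi> = T"
        using groupoid_connected[OF S(1) \<open>T \<in> objects\<close>] .
      have "act \<psi> (z (id_map S)) \<noteq> \<zero>"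
        using act_hom(7)[OF \<psi>(1), of "z (id_map S)" \<zero>] act_hom(5)[OF \<psi>(1)] S \<psi>(2)
          center_coeff_closed[OF z S(1)] object_closed(2)[OF S(1)] by auto
      then show ?thesis using centerD(3)[OF z \<psi>(1)] \<psi> by (simp add: support_def)
    qed
    then have "finite objects"
      using finite_objects carrierD(3)[OF centerD(2)[OF z]] by blast
    with assms show False by simp
  qed
  then show ?thesis using center_zero by blast
qed

section \<open>The center as a fixed field\<close>

lemma fixed_subfield: "subfield (fixed_elements G L) \<Omega>"
proof (rule subfieldI')
  note Lcl = object_closed[OF L_object]
  show "subring (fixed_elements G L) \<Omega>"
    by (rule subringI) (auto simp: fixed_elements_eq Lcl act_hom act_minus)
  fix k assume k: "k \<in> fixed_elements G L - {\<zero>}"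
  then have kL: "k \<in> L" "k \<noteq> \<zero>" by (auto simp: fixed_elements_eq)
  have unit: "k \<in> Units \<Omega>" using kL Lcl(1) by (simp add: field_Units)
  have iL: "inv k \<in> L" using Lcl(8) kL by blast
  have "act \<phi> (inv k) = inv k" if \<phi>: "\<phi> \<in> groupoid" "dom \<phi> = L" "ran \<phi> = L" for \<phi>
  proof -
    \<comment> \<open>As \<open>k\<close> is fixed, the image of its inverse is again an inverse of
      \<open>k\<close>, and inverses are unique.\<close>
    have "act \<phi> (inv k) \<otimes> k = act \<phi> (inv k \<otimes> k)"
      using k \<phi> act_hom(2)[OF \<phi>(1)] iL kL by (simp add: fixed_elements_eq)
    also have "\<dots> = \<one>" using unit act_hom(6)[OF \<phi>(1)] by simp
    finally show ?thesis
      using comm_inv_char[of "act \<phi> (inv k)" k] act_hom(1)[OF \<phi>(1)] iL kL Lcl(1) \<phi>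
        inv_unique[of "act \<phi> (inv k)" k "inv k"] unit by simp
  qed
  then show "inv k \<in> fixed_elements G L" using iL by (simp add: fixed_elements_eq)
qed

lemma A_ring:
  assumes "finite objects" shows "ring A"
proof (rule ringI)
  show "monoid A"
    using A_one_mult[OF assms] diagonal_one[OF assms]
    by (intro monoidI) (auto simp: A_mult_closed A_assoc diagonal_def)
qed (auto simp: A_abelian_group A_l_distr A_r_distr)

text \<open>This gives surjectivity of evaluation at \<open>id_map L\<close>. The coefficient at an
  object is \<open>c\<close> transported along some groupoid element from \<open>L\<close>;
  invariance of \<open>c\<close> makes the choice irrelevant.\<close>

lemma center_extension:
  assumes fin: "finite objects" and c: "c \<in> fixed_elements G L"
  obtains z where "z \<in> carrier (center A)" "z (id_map L) = c"
proof -
  have cL: "c \<in> L" using c by (simp add: fixed_elements_eq)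
  define from_L where "from_L S = (SOME \<phi>. \<phi> \<in> groupoid \<and> dom \<phi> = L \<and> ran \<phi> = S)" for S
  have from_L: "from_L S \<in> groupoid" "dom (from_L S) = L" "ran (from_L S) = S" if "S \<in> objects" for S
    unfolding from_L_def
    using groupoid_connected[OF L_object that] someI_ex[of "\<lambda>\<phi>. \<phi> \<in> groupoid \<and> dom \<phi> = L \<and> ran \<phi> = S"]
    by metis+
  \<comment> \<open>Two elements from \<open>L\<close> with a common range differ by an element from
    \<open>L\<close> to \<open>L\<close>, which fixes \<open>c\<close>.\<close>
  have indep: "act \<phi> c = act \<psi> c"
    if *: "\<phi> \<in> groupoid" "\<psi> \<in> groupoid" "dom \<phi> = L" "dom \<psi> = L" "ran \<phi> = ran \<psi>" for \<phi> \<psi>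
  proof -
    obtain \<psi>' where \<psi>': "\<psi>' \<in> groupoid" "dom \<psi>' = ran \<psi>" "ran \<psi>' = dom \<psi>"
      "\<psi> \<circ>\<^sub>m \<psi>' = id_map (ran \<psi>)"
      using groupoid_inverse[OF *(2)] by metis
    have cmp: "composable \<psi>' \<phi>" using * \<psi>' by (simp add: composable_def)
    have "act (\<psi>' \<circ>\<^sub>m \<phi>) c = c"
      using c comp_groupoid[OF \<psi>'(1) *(1) cmp] comp_dom[OF cmp] comp_ran[OF cmp] * \<psi>'
      by (simp add: fixed_elements_eq)
    then have "act \<psi> c = act (\<psi> \<circ>\<^sub>m (\<psi>' \<circ>\<^sub>m \<phi>)) c"
      using act_comp[of c "\<psi>' \<circ>\<^sub>m \<phi>" \<psi>] comp_dom[OF cmp] * cL by simp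
    also have "\<psi> \<circ>\<^sub>m (\<psi>' \<circ>\<^sub>m \<phi>) = \<phi>"
      unfolding comp_assoc[symmetric] \<psi>'(4) using *(5) by (simp add: id_comp)
    finally show ?thesis by simp
  qed
  define z where "z = (\<lambda>\<phi>. if \<phi> \<in> id_map ` objects then act (from_L (ran \<phi>)) c else \<zero>)"
  have z_eq: "z (id_map (ran \<psi>)) = act \<psi> c" if "\<psi> \<in> groupoid" "dom \<psi> = L" for \<psi>
  proof -
    have "act (from_L (ran \<psi>)) c = act \<psi> c"
      using indep[OF from_L(1)[OF ran_object[OF that(1)]] that(1)] from_L[OF ran_object[OF that(1)]] that
      by simp
    then show ?thesis using ran_object[OF that(1)] by (simp add: z_def)
  qed
  have supp: "support \<Omega> z \<subseteq> id_map ` objects" by (auto simp: z_def support_def)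
  have "z \<in> carrier A"
  proof (rule carrierI[OF _ supp])
    fix \<phi> assume \<phi>: "\<phi> \<in> groupoid"
    show "z \<phi> \<in> ran \<phi>"
      using act_hom(1)[OF from_L(1)] from_L ran_object[OF \<phi>] cL ran_closed(2)[OF \<phi>]
      by (simp add: z_def)
  qed (use fin id_map_groupoid in auto)
  then have "diagonal z" using supp by (simp add: diagonal_def)
  moreover have "z (id_map (ran \<psi>)) = act \<psi> (z (id_map (dom \<psi>)))" if \<psi>: "\<psi> \<in> groupoid" for \<psi>
  proof -
    \<comment> \<open>The chosen path to \<open>dom \<psi>\<close> followed by \<psi> is a path to
      \<open>ran \<psi>\<close>, so independence of the path yields the transport relation.\<close>
    let ?\<phi> = "from_L (dom \<psi>)"
    have \<phi>: "?\<phi> \<in> groupoid" "dom ?\<phi> = L" "ran ?\<phi> = dom \<psi>"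
      using from_L[OF dom_object[OF \<psi>]] by auto
    have cmp: "composable \<psi> ?\<phi>" using \<phi> by (simp add: composable_def)
    have "z (id_map (ran \<psi>)) = act (\<psi> \<circ>\<^sub>m ?\<phi>) c"
      using z_eq[OF comp_groupoid[OF \<psi> \<phi>(1) cmp]] comp_dom[OF cmp] comp_ran[OF cmp] \<phi> by simp
    also have "\<dots> = act \<psi> (z (id_map (dom \<psi>)))"
      using act_comp[of c ?\<phi> \<psi>] \<phi> cL z_eq[OF \<phi>(1,2)] by simp
    finally show ?thesis .
  qed
  ultimately have "z \<in> carrier (center A)" unfolding center_iff by blast
  moreover have "z (id_map L) = c"
    using z_eq[OF id_map_groupoid[OF L_object]] cL by (simp add: act_id_map)
  ultimately show thesis by (rule that)
qed

text \<open>Central elements are diagonal, so at an identity their product is the product of the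
  coefficients. Transport from \<open>L\<close> determines all other coefficients, which gives
  injectivity.\<close>

lemma center_iso:
  assumes fin: "finite objects"
  shows "(\<lambda>z. z (id_map L)) \<in> ring_iso (center A) (\<Omega>\<lparr>carrier := fixed_elements G L\<rparr>)"
proof (rule ring_iso_memI)
  have gr: "id_map L \<in> groupoid" using id_map_groupoid[OF L_object] .
  show fixed: "z (id_map L) \<in> carrier (\<Omega>\<lparr>carrier := fixed_elements G L\<rparr>)"
    if z: "z \<in> carrier (center A)" for z
  proof -
    have "act \<phi> (z (id_map L)) = z (id_map L)"
      if "\<phi> \<in> groupoid" "dom \<phi> = L" "ran \<phi> = L" for \<phi>
      using centerD(3)[OF z that(1)] that(2,3) by simp
    then show ?thesis
      using center_coeff_closed[OF z L_object] by (simp add: fixed_elements_eq)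
  qed
  show "\<one>\<^bsub>center A\<^esub> (id_map L) = \<one>\<^bsub>\<Omega>\<lparr>carrier := fixed_elements G L\<rparr>\<^esub>"
    using L_object by (simp add: center_def A_one)
  show "bij_betw (\<lambda>z. z (id_map L)) (carrier (center A)) (carrier (\<Omega>\<lparr>carrier := fixed_elements G L\<rparr>))"
  proof (rule bij_betw_imageI)
    show "inj_on (\<lambda>z. z (id_map L)) (carrier (center A))"
    proof (rule inj_onI)
      fix z w assume z: "z \<in> carrier (center A)" and w: "w \<in> carrier (center A)"
        and eq: "z (id_map L) = w (id_map L)"
      have on_ids: "z (id_map S) = w (id_map S)" if S: "S \<in> objects" for S
        using groupoid_connected[OF L_object S] centerD(3)[OF z] centerD(3)[OF w] eq by metis
      show "z = w"
      proof
        fix \<phi>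
        have "z \<phi> = \<zero>" "w \<phi> = \<zero>" if "\<phi> \<notin> id_map ` objects"
          using that centerD(1)[OF z] centerD(1)[OF w] unfolding diagonal_def support_def by blast+
        then show "z \<phi> = w \<phi>" using on_ids by (cases "\<phi> \<in> id_map ` objects") auto
      qed
    qed
    show "(\<lambda>z. z (id_map L)) ` carrier (center A) = carrier (\<Omega>\<lparr>carrier := fixed_elements G L\<rparr>)"
    proof
      show "(\<lambda>z. z (id_map L)) ` carrier (center A) \<subseteq> carrier (\<Omega>\<lparr>carrier := fixed_elements G L\<rparr>)"
        by (intro image_subsetI fixed)
      show "carrier (\<Omega>\<lparr>carrier := fixed_elements G L\<rparr>) \<subseteq> (\<lambda>z. z (id_map L)) ` carrier (center A)"
      proof
        fix c assume "c \<in> carrier (\<Omega>\<lparr>carrier := fixed_elements G L\<rparr>)"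
        then obtain z where "z \<in> carrier (center A)" "z (id_map L) = c"
          using center_extension[OF fin, of c] by auto
        then show "c \<in> (\<lambda>z. z (id_map L)) ` carrier (center A)" by (intro image_eqI) simp_all
      qed
    qed
  qed
  fix z w assume z: "z \<in> carrier (center A)" and w: "w \<in> carrier (center A)"
  have "w (id_map L) \<in> L" using center_coeff_closed[OF w L_object] .
  then show "(z \<otimes>\<^bsub>center A\<^esub> w) (id_map L) =
      z (id_map L) \<otimes>\<^bsub>\<Omega>\<lparr>carrier := fixed_elements G L\<rparr>\<^esub> w (id_map L)"
    using mult_diagonal(1)[OF centerD(1)[OF z] centerD(2)[OF w] gr] by (simp add: center_def)
  show "(z \<oplus>\<^bsub>center A\<^esub> w) (id_map L) =
      z (id_map L) \<oplus>\<^bsub>\<Omega>\<lparr>carrier := fixed_elements G L\<rparr>\<^esub> w (id_map L)"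
    by (simp add: center_def A_add)
qed

text \<open>The field structure is carried back from the fixed field along the inverse of the
  evaluation isomorphism.\<close>

lemma center_field:
  assumes "finite objects" shows "field (center A)"
proof -
  let ?h = "\<lambda>z. z (id_map L)"
  let ?h' = "inv_into (carrier (center A)) ?h"
  interpret F: field "\<Omega>\<lparr>carrier := fixed_elements G L\<rparr>"
    using subfield_iff(2)[OF fixed_subfield] .
  have "?h' \<in> ring_iso (\<Omega>\<lparr>carrier := fixed_elements G L\<rparr>) (center A)"
    using ring_iso_set_sym[OF ring.center_ring[OF A_ring[OF assms]] center_iso[OF assms]] .
  \<comment> \<open>The transfer rule resets the zero of the target to the image of zero; the two
    facts after it show that the record is unchanged.\<close>
  from F.ring_iso_imp_img_field[OF this]
  have "field (center A\<lparr>zero := ?h' \<zero>\<rparr>)" by simp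
  moreover have "?h' \<zero> = \<zero>\<^bsub>A\<^esub>"
    using inv_into_f_f[OF bij_betw_imp_inj_on[OF ring_iso_memE(5)[OF center_iso[OF assms]]] center_zero]
    by (simp add: A_zero)
  moreover have "center A\<lparr>zero := \<zero>\<^bsub>A\<^esub>\<rparr> = center A" by (simp add: center_def)
  ultimately show ?thesis by simp
qed

end

theorem proposition18:
  fixes \<Omega> :: "('a, 'm) ring_scheme"
    and K L N :: "'a set"
    and G :: "('a \<Rightarrow> 'a) set"
    and I :: "'a set set"
    and \<beta> :: "('a \<rightharpoonup> 'a) \<Rightarrow> ('a \<rightharpoonup> 'a) \<Rightarrow> 'a"
    and A :: "('a, ('a \<rightharpoonup> 'a) \<Rightarrow> 'a) module"
  assumes "algebraic_closure \<Omega> K"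
    and "separable_extension \<Omega> K L"
    and "normal_closure \<Omega> K L N"
    and "G = galois_group \<Omega> K N"
    and "I = conjugate_fields G L"
    and "cocycle \<Omega> (conj_groupoid G L) \<beta>"
    and "A = crossed_product \<Omega> G L \<beta>"
  shows "simple_algebra (\<Omega>\<lparr>carrier := K\<rparr>) A \<and>
    (unital A \<longleftrightarrow> finite I) \<and>
    (finite I \<longrightarrow>
       field (center A) \<and> center A \<simeq> \<Omega>\<lparr>carrier := fixed_elements G L\<rparr>) \<and>
    (infinite I \<longrightarrow> carrier (center A) = {\<zero>\<^bsub>A\<^esub>})"
proof -
  \<comment> \<open>The locale assumptions are read off: \<Omega> is a field as an algebraic
    closure, \<open>N\<close> comes from the normal closure, and the facts on \<open>K\<close> and
    \<open>L\<close> come from separability.\<close>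
  have "field \<Omega>" and N: "subfield N \<Omega>" and L_subset: "L \<subseteq> N"
    using assms(1,3) by (auto simp: algebraic_closure_def normal_closure_def normal_extension_def)
  then interpret galois_object_crossed_product \<Omega> K L N G \<beta>
    using assms(2,4,6)
    by (intro galois_object_crossed_product.intro galois_conjugates.intro
        galois_conjugates_axioms.intro galois_object_crossed_product_axioms.intro)
      (auto simp: separable_extension_def)
  show ?thesis
    unfolding assms(5,7)
    using A_simple unital_iff center_field center_iso center_infinite
    by (auto simp: is_ring_iso_def)
qed

end
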